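(* Let $M$ be a smooth closed orientable connected manifold, and let $R=\mathbb{Z}$ or let $R$ be a field with $\operatorname{char}R=0$. Then $$b_1'(M)\le h(M;R)\le b_1(M).$$
   Context: $b_1'(M)$, the co-rank of the fundamental group, is the maximum rank of a free quotient group of $\pi_1(M)$. $b_1(M)=\operatorname{rk}H_1(M;\mathbb{Z})$ is the first Betti number. Modules over $R$ are vector spaces if $R$ is a field and abelian groups if $R=\mathbb{Z}$; submodule means subspace or subgroup, and rank means dimension or rank of an abelian group, respectively. A submodule $H\subseteq H^1(M;R)$ is isotropic if $x\smile y=0$ in $H^2(M;R)$ for all $x,y\in H$, where $\smile$ is the cup product. The isotropy index $h(M;R)$ is the maximum rank of an isotropic submodule of $H^1(M;R)$. *)

theory Defs
  imports
    "HOL-Analysis.Analysis"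
    "HOL-Homology.Homology"
    "HOL-Library.Extended_Nat"
    "HOL-Algebra.Module"
    "HOL-Algebra.Algebraic_Closure_Type"
    "Jordan_Normal_Form.Determinant"
begin

section \<open>Smooth manifolds\<close>

text \<open>
  The model space is \<^term>\<open>Euclidean_space n\<close>, whose points are the functions
  \<open>nat \<Rightarrow> real\<close> vanishing from index \<open>n\<close> on; in particular \<open>n = 0\<close> is allowed.
\<close>

definition partial_deriv :: "nat \<Rightarrow> ((nat \<Rightarrow> real) \<Rightarrow> real) \<Rightarrow> (nat \<Rightarrow> real) \<Rightarrow> real" where
  "partial_deriv i f x = deriv (\<lambda>t. f (x(i := t))) (x i)"

text \<open>
  \<open>Ck_on n k W f\<close>, for \<open>W\<close> open in \<^term>\<open>Euclidean_space n\<close>: all partial derivatives of \<open>f\<close>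
  of order at most \<open>k\<close> exist and are continuous on \<open>W\<close>.
\<close>

primrec Ck_on ::
  "nat \<Rightarrow> nat \<Rightarrow> (nat \<Rightarrow> real) set \<Rightarrow> ((nat \<Rightarrow> real) \<Rightarrow> real) \<Rightarrow> bool" where
  "Ck_on n 0 W f \<longleftrightarrow> continuous_map (subtopology (Euclidean_space n) W) euclideanreal f"
| "Ck_on n (Suc k) W f \<longleftrightarrow>
     continuous_map (subtopology (Euclidean_space n) W) euclideanreal f \<and>
     (\<forall>i<n. (\<forall>x\<in>W. (\<lambda>t. f (x(i := t))) differentiable (at (x i))) \<and>
            Ck_on n k W (partial_deriv i f))"

definition smooth_map_on ::
  "nat \<Rightarrow> nat \<Rightarrow> (nat \<Rightarrow> real) set \<Rightarrow> ((nat \<Rightarrow> real) \<Rightarrow> (nat \<Rightarrow> real)) \<Rightarrow> bool" where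
  "smooth_map_on n m W F \<longleftrightarrow> (\<forall>j<m. \<forall>k. Ck_on n k W (\<lambda>x. F x j))"

type_synonym 'a chart = "'a set \<times> ('a \<Rightarrow> nat \<Rightarrow> real)"

definition is_chart :: "'a topology \<Rightarrow> nat \<Rightarrow> 'a chart \<Rightarrow> bool" where
  "is_chart T n = (\<lambda>(U, f).
     openin T U \<and> openin (Euclidean_space n) (f ` U) \<and>
     homeomorphic_map (subtopology T U) (subtopology (Euclidean_space n) (f ` U)) f)"

definition transition_dom :: "'a chart \<Rightarrow> 'a chart \<Rightarrow> (nat \<Rightarrow> real) set" where
  "transition_dom = (\<lambda>(U, f) (V, g). f ` (U \<inter> V))"

definition transition :: "'a chart \<Rightarrow> 'a chart \<Rightarrow> (nat \<Rightarrow> real) \<Rightarrow> (nat \<Rightarrow> real)" where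
  "transition = (\<lambda>(U, f) (V, g). g \<circ> inv_into U f)"

definition smooth_atlas :: "'a topology \<Rightarrow> nat \<Rightarrow> 'a chart set \<Rightarrow> bool" where
  "smooth_atlas T n A \<longleftrightarrow>
     (\<forall>c\<in>A. is_chart T n c) \<and>
     (\<Union>c\<in>A. fst c) = topspace T \<and>
     (\<forall>c\<in>A. \<forall>d\<in>A. smooth_map_on n n (transition_dom c d) (transition c d))"

text \<open>Charts map onto open subsets of the whole Euclidean space: there is no boundary.\<close>

definition smooth_manifold :: "'a topology \<Rightarrow> nat \<Rightarrow> 'a chart set \<Rightarrow> bool" where
  "smooth_manifold T n A \<longleftrightarrow>
     Hausdorff_space T \<and> second_countable T \<and> smooth_atlas T n A"

definition jacobian :: "nat \<Rightarrow> ((nat \<Rightarrow> real) \<Rightarrow> (nat \<Rightarrow> real)) \<Rightarrow> (nat \<Rightarrow> real) \<Rightarrow> real mat" where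
  "jacobian n F x = Matrix.mat n n (\<lambda>(i, j). partial_deriv j (\<lambda>y. F y i) x)"

definition oriented_atlas :: "nat \<Rightarrow> 'a chart set \<Rightarrow> bool" where
  "oriented_atlas n B \<longleftrightarrow>
     (\<forall>c\<in>B. \<forall>d\<in>B. \<forall>x\<in>transition_dom c d.
        Determinant.det (jacobian n (transition c d) x) > 0)"

text \<open>\<open>smooth_atlas T n (A \<union> B)\<close> says that \<open>A\<close> and \<open>B\<close> define the same smooth structure.\<close>

definition orientable_manifold :: "'a topology \<Rightarrow> nat \<Rightarrow> 'a chart set \<Rightarrow> bool" where
  "orientable_manifold T n A \<longleftrightarrow>
     (\<exists>B. smooth_atlas T n B \<and> smooth_atlas T n (A \<union> B) \<and> oriented_atlas n B)"

section \<open>The fundamental group\<close>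

definition loops :: "'a topology \<Rightarrow> 'a \<Rightarrow> (real \<Rightarrow> 'a) set" where
  "loops T x0 = {g. pathin T g \<and> g 0 = x0 \<and> g 1 = x0}"

definition loop_rel :: "'a topology \<Rightarrow> 'a \<Rightarrow> ((real \<Rightarrow> 'a) \<times> (real \<Rightarrow> 'a)) set" where
  "loop_rel T x0 = {(p, q).
     homotopic_with (\<lambda>g. g 0 = x0 \<and> g 1 = x0) (top_of_set {0..1}) T p q}"

text \<open>The library's \<open>+++\<close> needs a type of class \<open>topological_space\<close>.\<close>

definition loop_join :: "(real \<Rightarrow> 'a) \<Rightarrow> (real \<Rightarrow> 'a) \<Rightarrow> real \<Rightarrow> 'a" where
  "loop_join p q = (\<lambda>t. if t \<le> 1/2 then p (2 * t) else q (2 * t - 1))"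

definition fundamental_group :: "'a topology \<Rightarrow> 'a \<Rightarrow> (real \<Rightarrow> 'a) set monoid" where
  "fundamental_group T x0 =
     \<lparr>carrier = loops T x0 // loop_rel T x0,
      monoid.mult = (\<lambda>A B. \<Union>p\<in>A. \<Union>q\<in>B. loop_rel T x0 `` {loop_join p q}),
      one = loop_rel T x0 `` {\<lambda>_. x0}\<rparr>"

section \<open>Free quotients and the co-rank of a group\<close>

text \<open>A letter \<open>(x, True)\<close> stands for \<open>x\<close>, and \<open>(x, False)\<close> for the inverse of \<open>x\<close>.\<close>

definition word_value :: "('g, 'm) monoid_scheme \<Rightarrow> ('g \<times> bool) list \<Rightarrow> 'g" where
  "word_value G w =
     foldr (\<lambda>(x, e) y. (if e then x else inv\<^bsub>G\<^esub> x) \<otimes>\<^bsub>G\<^esub> y) w \<one>\<^bsub>G\<^esub>"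

definition reduced_word :: "('g \<times> bool) list \<Rightarrow> bool" where
  "reduced_word = successively (\<lambda>(x, e) (y, f). \<not> (x = y \<and> e \<noteq> f))"

definition free_basis :: "('g, 'm) monoid_scheme \<Rightarrow> 'g set \<Rightarrow> bool" where
  "free_basis G B \<longleftrightarrow>
     B \<subseteq> carrier G \<and> generate G B = carrier G \<and>
     (\<forall>w. w \<noteq> [] \<and> fst ` set w \<subseteq> B \<and> reduced_word w \<longrightarrow> word_value G w \<noteq> \<one>\<^bsub>G\<^esub>)"

definition ecard :: "'b set \<Rightarrow> enat" where
  "ecard B = (if finite B then enat (card B) else \<infinity>)"

text \<open>
  Maximal ranks are taken as suprema in \<^typ>\<open>enat\<close>; such a supremum is a maximum whenever
  it is finite.
\<close>

definition corank :: "('g, 'm) monoid_scheme \<Rightarrow> enat" where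
  "corank G = Sup {ecard B | N B. N \<lhd> G \<and> free_basis (G Mod N) B}"

section \<open>Ranks of abelian groups and modules\<close>

definition abelian_group_rank :: "('g, 'm) monoid_scheme \<Rightarrow> enat" where
  "abelian_group_rank G =
     Sup {enat (card B) | B. finite B \<and> B \<subseteq> carrier G \<and>
       (\<forall>c :: 'g \<Rightarrow> int. finprod G (\<lambda>b. b [^]\<^bsub>G\<^esub> c b) B = \<one>\<^bsub>G\<^esub> \<longrightarrow> (\<forall>b\<in>B. c b = 0))}"

text \<open>
  The rank of a submodule \<open>H\<close> of \<open>M\<close>: its dimension if \<open>R\<close> is a field, its rank as an abelian
  group if \<open>R\<close> is the ring of integers.
\<close>

definition submodule_rank ::
  "('r, 'k) ring_scheme \<Rightarrow> ('r, 'v, 'm) module_scheme \<Rightarrow> 'v set \<Rightarrow> enat" where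
  "submodule_rank R M H =
     Sup {enat (card B) | B. finite B \<and> B \<subseteq> H \<and>
       (\<forall>c \<in> B \<rightarrow> carrier R.
          finsum M (\<lambda>b. c b \<odot>\<^bsub>M\<^esub> b) B = \<zero>\<^bsub>M\<^esub> \<longrightarrow> (\<forall>b\<in>B. c b = \<zero>\<^bsub>R\<^esub>))}"

section \<open>Singular cohomology and the cup product\<close>

text \<open>
  A cochain, being a homomorphism from the free abelian group on the singular simplices, is
  given by its values on simplices; it is set to \<open>0\<close> elsewhere for canonicity.
\<close>

type_synonym ('a, 'r) cochain = "((nat \<Rightarrow> real) \<Rightarrow> 'a) \<Rightarrow> 'r"

definition cochains :: "nat \<Rightarrow> 'a topology \<Rightarrow> ('a, 'r::comm_ring_1) cochain set" where
  "cochains p T = {c. \<forall>\<sigma>. \<not> singular_simplex p T \<sigma> \<longrightarrow> c \<sigma> = 0}"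

text \<open>Maps \<open>p\<close>-cochains to \<open>(p + 1)\<close>-cochains, dually to \<^const>\<open>chain_boundary\<close>.\<close>

definition coboundary ::
  "nat \<Rightarrow> 'a topology \<Rightarrow> ('a, 'r::comm_ring_1) cochain \<Rightarrow> ('a, 'r) cochain" where
  "coboundary p T c = (\<lambda>\<sigma>. if singular_simplex (Suc p) T \<sigma>
     then \<Sum>k\<le>Suc p. (-1) ^ k * c (singular_face (Suc p) k \<sigma>) else 0)"

definition cocycles :: "nat \<Rightarrow> 'a topology \<Rightarrow> ('a, 'r::comm_ring_1) cochain set" where
  "cocycles p T = {c \<in> cochains p T. coboundary p T c = (\<lambda>_. 0)}"

definition coboundaries :: "nat \<Rightarrow> 'a topology \<Rightarrow> ('a, 'r::comm_ring_1) cochain set" where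
  "coboundaries p T =
     (case p of 0 \<Rightarrow> {\<lambda>_. 0} | Suc q \<Rightarrow> coboundary q T ` cochains q T)"

definition cohomologous ::
  "nat \<Rightarrow> 'a topology \<Rightarrow> (('a, 'r::comm_ring_1) cochain \<times> ('a, 'r) cochain) set" where
  "cohomologous p T = {(a, b). a \<in> cocycles p T \<and> b \<in> cocycles p T \<and>
     (\<lambda>\<sigma>. a \<sigma> - b \<sigma>) \<in> coboundaries p T}"

text \<open>
  The \<open>p\<close>-th cohomology as a module over \<^const>\<open>ring_of_type_algebra\<close>; the multiplicative
  fields of the record play no role in a module.
\<close>

definition cohomology ::
  "nat \<Rightarrow> 'a topology \<Rightarrow> ('r::comm_ring_1, ('a, 'r) cochain set) module" where
  "cohomology p T =
     \<lparr>carrier = cocycles p T // cohomologous p T,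
      monoid.mult = undefined,
      one = undefined,
      ring.zero = cohomologous p T `` {\<lambda>_. 0},
      add = (\<lambda>A B. \<Union>a\<in>A. \<Union>b\<in>B. cohomologous p T `` {\<lambda>\<sigma>. a \<sigma> + b \<sigma>}),
      smult = (\<lambda>r A. \<Union>a\<in>A. cohomologous p T `` {\<lambda>\<sigma>. r * a \<sigma>})\<rparr>"

definition front_face :: "nat \<Rightarrow> ((nat \<Rightarrow> real) \<Rightarrow> 'a) \<Rightarrow> (nat \<Rightarrow> real) \<Rightarrow> 'a" where
  "front_face p \<sigma> = restrict \<sigma> (standard_simplex p)"

definition back_face :: "nat \<Rightarrow> nat \<Rightarrow> ((nat \<Rightarrow> real) \<Rightarrow> 'a) \<Rightarrow> (nat \<Rightarrow> real) \<Rightarrow> 'a" where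
  "back_face p q \<sigma> =
     restrict (\<sigma> \<circ> (\<lambda>x i. if i < p then 0 else x (i - p))) (standard_simplex q)"

definition cochain_cup ::
  "nat \<Rightarrow> nat \<Rightarrow> 'a topology \<Rightarrow> ('a, 'r::comm_ring_1) cochain \<Rightarrow> ('a, 'r) cochain
     \<Rightarrow> ('a, 'r) cochain" where
  "cochain_cup p q T a b = (\<lambda>\<sigma>. if singular_simplex (p + q) T \<sigma>
     then a (front_face p \<sigma>) * b (back_face p q \<sigma>) else 0)"

definition cup_product ::
  "nat \<Rightarrow> nat \<Rightarrow> 'a topology \<Rightarrow> ('a, 'r::comm_ring_1) cochain set \<Rightarrow> ('a, 'r) cochain set
     \<Rightarrow> ('a, 'r) cochain set" where
  "cup_product p q T A B =
     (\<Union>a\<in>A. \<Union>b\<in>B. cohomologous (p + q) T `` {cochain_cup p q T a b})"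

section \<open>The three invariants\<close>

definition isotropic :: "'a topology \<Rightarrow> ('a, 'r::comm_ring_1) cochain set set \<Rightarrow> bool" where
  "isotropic T H \<longleftrightarrow>
     submodule H (ring_of_type_algebra :: 'r ring) (cohomology 1 T) \<and>
     (\<forall>x\<in>H. \<forall>y\<in>H. cup_product 1 1 T x y = \<zero>\<^bsub>cohomology 2 T\<^esub>)"

definition isotropy_index :: "'r::comm_ring_1 itself \<Rightarrow> 'a topology \<Rightarrow> enat" where
  "isotropy_index _ T =
     Sup {submodule_rank (ring_of_type_algebra :: 'r ring) (cohomology 1 T) H | H. isotropic T H}"

definition first_betti :: "'a topology \<Rightarrow> enat" where
  "first_betti T = abelian_group_rank (homology_group 1 T)"

definition pi1_corank :: "'a topology \<Rightarrow> 'a \<Rightarrow> enat" where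
  "pi1_corank T x0 = corank (fundamental_group T x0)"

end

theory Submission
  imports Defs
begin

text \<open>
  Write \<open>\<pi>\<close> for the fundamental group. Both inequalities are read off from what a first cohomology
  class is: a homomorphism from \<open>\<pi>\<close>, or equally from \<open>H\<^sub>1\<close>, to the coefficient ring \<open>R\<close>.

  Upper bound. A 1-cocycle is evaluated on 1-cycles, the value depends only on the homology class,
  and a cocycle that vanishes on all cycles is a coboundary
  (\<open>cocycle_vanishing_on_cycles_is_coboundary\<close>). Since \<open>R\<close> is a domain of characteristic 0, a
  homomorphism \<open>H\<^sub>1 \<rightarrow> R\<close> is determined by its values on a maximal independent set \<open>E\<close> of homology
  classes (\<open>additive_vanishing_on_maximal_independent\<close>). A linear relation between cohomology classes
  is therefore a system of \<open>card E\<close> linear equations, and as soon as there are more classes than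
  equations it has a nontrivial solution. So at most \<open>card E\<close> classes of \<open>H\<^sup>1\<close> are independent.

  Lower bound. Let \<open>F\<close> be a free quotient of \<open>\<pi>\<close> with basis \<open>B\<close>. Every homomorphism \<open>f : F \<rightarrow> R\<close> gives
  a class, and the classes of the coordinate functions of finitely many elements of \<open>B\<close> are
  independent, because they can be told apart on loops that represent these elements. The cup
  products of such classes vanish because a free group has no second cohomology. In concrete terms,
  freeness lifts the pair \<open>(f, g)\<close> to a homomorphism from \<open>F\<close> to the Heisenberg group over \<open>R\<close>, whose
  last coordinate \<open>h\<close> satisfies \<open>h (x y) = h x + h y + f x * g y\<close> (\<open>free_basis_product_primitive\<close>);
  this says that the cup product of \<open>f\<close> and \<open>g\<close> is the coboundary of \<open>- h\<close>.

  What carries functions on \<open>F\<close> over to cochains on the space, without any classifying space, is a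
  labelling of the singular 1-simplices by elements of \<open>\<pi>\<close> (\<open>exists_edge_labelling\<close>): fix a path from
  the base point to each point of its path component, and close up every 1-simplex to a loop with
  these paths. The edges of a singular triangle then satisfy \<open>02 = 01 \<cdot> 12\<close> in \<open>\<pi>\<close>, so that an
  identity in \<open>F\<close> about products of two elements becomes an identity of cochains on triangles.
\<close>

section \<open>Free groups and their maps to the Heisenberg group\<close>

definition word_inverse :: "('g \<times> bool) list \<Rightarrow> ('g \<times> bool) list" where
  "word_inverse w = rev (map (\<lambda>(x, e). (x, \<not> e)) w)"

lemma fst_set_word_inverse [simp]: "fst ` set (word_inverse w) = fst ` set w"
  by (auto simp: word_inverse_def image_image case_prod_unfold)

lemma map_word_inverse: "map (apfst \<phi>) (word_inverse w) = word_inverse (map (apfst \<phi>) w)"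
  by (simp add: word_inverse_def rev_map case_prod_unfold apfst_def map_prod_def)

context group
begin

lemma word_value_Nil [simp]: "word_value G [] = \<one>"
  by (simp add: word_value_def)

lemma word_value_Cons [simp]:
  "word_value G (xe # w) = (if snd xe then fst xe else inv (fst xe)) \<otimes> word_value G w"
  by (cases xe) (simp add: word_value_def)

lemma word_value_closed [simp]: "fst ` set w \<subseteq> carrier G \<Longrightarrow> word_value G w \<in> carrier G"
  by (induction w) auto

lemma word_value_append:
  "\<lbrakk>fst ` set v \<subseteq> carrier G; fst ` set w \<subseteq> carrier G\<rbrakk>
    \<Longrightarrow> word_value G (v @ w) = word_value G v \<otimes> word_value G w"
  by (induction v) (auto simp: m_assoc)

lemma word_value_word_inverse:
  "fst ` set w \<subseteq> carrier G \<Longrightarrow> word_value G (word_inverse w) = inv (word_value G w)"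
proof (induction w)
  case (Cons xe w)
  have "word_inverse (xe # w) = word_inverse w @ [(fst xe, \<not> snd xe)]"
    by (simp add: word_inverse_def case_prod_unfold)
  moreover have "fst ` set (word_inverse w) \<subseteq> carrier G"
    using Cons.prems by simp
  ultimately show ?case
    using Cons by (auto simp: word_value_append inv_mult_group)
qed (simp add: word_inverse_def)

lemma word_value_cancel:
  assumes "fst ` set (u @ (x, e) # (x, \<not> e) # v) \<subseteq> carrier G"
  shows "word_value G (u @ (x, e) # (x, \<not> e) # v) = word_value G (u @ v)"
proof -
  have "x \<in> carrier G" "fst ` set u \<subseteq> carrier G" "fst ` set v \<subseteq> carrier G"
    using assms by auto
  then show ?thesis
    by (auto simp: word_value_append m_assoc inv_solve_left' simp flip: m_assoc[of "inv x"] m_assoc[of x "inv x"])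
qed

lemma generate_eq_word_values:
  assumes "B \<subseteq> carrier G" "a \<in> generate G B"
  shows "\<exists>w. fst ` set w \<subseteq> B \<and> word_value G w = a"
  using assms(2)
proof (induction rule: generate.induct)
  case one
  show ?case by (rule exI[of _ "[]"]) simp
next
  case (incl h)
  then show ?case using assms(1) by (intro exI[of _ "[(h, True)]"]) auto
next
  case (inv h)
  then show ?case using assms(1) by (intro exI[of _ "[(h, False)]"]) auto
next
  case (eng h1 h2)
  then obtain v w where "fst ` set v \<subseteq> B" "word_value G v = h1" "fst ` set w \<subseteq> B" "word_value G w = h2"
    by blast
  with assms(1) show ?case
    by (intro exI[of _ "v @ w"]) (auto simp: word_value_append image_Un subset_trans)
qed

end

lemma not_reduced_word:
  "\<not> reduced_word w \<Longrightarrow> \<exists>u x e v. w = u @ (x, e) # (x, \<not> e) # v"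
proof (induction w rule: induct_list012)
  case (3 a b w)
  obtain x e y f where ab: "a = (x, e)" "b = (y, f)" by (cases a, cases b)
  show ?case
  proof (cases "x = y \<and> e \<noteq> f")
    case True
    then show ?thesis using ab by (intro exI[of _ "[]"]) auto
  next
    case False
    then have "\<not> reduced_word (b # w)"
      using 3 ab by (auto simp: reduced_word_def)
    then obtain u x e v where "b # w = u @ (x, e) # (x, \<not> e) # v" using 3 by blast
    then show ?thesis by (intro exI[of _ "a # u"]) auto
  qed
qed (auto simp: reduced_word_def)

text \<open>
  A word that represents the identity of a free group is not reduced unless it is empty, hence it
  contains a letter next to its inverse. Cancelling the pair changes neither value, so that
  induction on the length applies.
\<close>

lemma free_basis_relation_maps_to_one:
  assumes F: "group F" "free_basis F B" and K: "group K" "\<phi> \<in> B \<rightarrow> carrier K"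
    and "fst ` set w \<subseteq> B" "word_value F w = \<one>\<^bsub>F\<^esub>"
  shows "word_value K (map (apfst \<phi>) w) = \<one>\<^bsub>K\<^esub>"
  using assms(5,6)
proof (induction w rule: length_induct)
  case (1 w)
  interpret F: group F by fact
  interpret K: group K by fact
  have BF: "B \<subseteq> carrier F" using F by (simp add: free_basis_def)
  show ?case
  proof (cases "w = []")
    case False
    then have "\<not> reduced_word w"
      using F 1 by (auto simp: free_basis_def)
    then obtain u x e v where w: "w = u @ (x, e) # (x, \<not> e) # v"
      using not_reduced_word by blast
    have "word_value F (u @ v) = \<one>\<^bsub>F\<^esub>"
      using 1(2,3) BF F.word_value_cancel[of u x e v] unfolding w by (metis order.trans)
    moreover have "length (u @ v) < length w" "fst ` set (u @ v) \<subseteq> B"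
      using 1(2) by (auto simp: w)
    ultimately have "word_value K (map (apfst \<phi>) (u @ v)) = \<one>\<^bsub>K\<^esub>"
      using 1(1) by blast
    moreover have "fst ` set (map (apfst \<phi>) w) \<subseteq> carrier K"
      using 1(2) K(2) by (auto simp: image_image Pi_iff)
    ultimately show ?thesis
      using K.word_value_cancel[of "map (apfst \<phi>) u" "\<phi> x" e "map (apfst \<phi>) v"] by (simp add: w)
  qed simp
qed

text \<open>
  The universal property of free groups. The image of an element is computed from any word that
  represents it; two such words differ by a relation, and relations are mapped to the identity.
\<close>

lemma free_basis_extend_hom:
  assumes F: "group F" "free_basis F B" and K: "group K" "\<phi> \<in> B \<rightarrow> carrier K"
  shows "\<exists>\<Phi>\<in>hom F K. \<forall>b\<in>B. \<Phi> b = \<phi> b"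
proof -
  interpret F: group F by fact
  interpret K: group K by fact
  have BF: "B \<subseteq> carrier F" and gen: "generate F B = carrier F"
    using F by (auto simp: free_basis_def)
  define \<psi> where "\<psi> w = word_value K (map (apfst \<phi>) w)" for w
  have img: "fst ` set (map (apfst \<phi>) w) \<subseteq> carrier K" if "fst ` set w \<subseteq> B" for w :: "('a \<times> bool) list"
    using that K(2) by (auto simp: image_image Pi_iff)
  have sub: "fst ` set w \<subseteq> carrier F" if "fst ` set w \<subseteq> B" for w :: "('a \<times> bool) list"
    using that BF by blast
  have wd: "\<psi> v = \<psi> w"
    if "fst ` set v \<subseteq> B" "fst ` set w \<subseteq> B" "word_value F v = word_value F w" for v w
  proof -
    have "word_value F (v @ word_inverse w) = \<one>\<^bsub>F\<^esub>"
      using that sub by (simp add: F.word_value_append F.word_value_word_inverse)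
    then have "word_value K (map (apfst \<phi>) (v @ word_inverse w)) = \<one>\<^bsub>K\<^esub>"
      using that by (intro free_basis_relation_maps_to_one[OF assms]) (auto simp: image_Un)
    then have "\<psi> v \<otimes>\<^bsub>K\<^esub> inv\<^bsub>K\<^esub> \<psi> w = \<one>\<^bsub>K\<^esub>"
      using img[OF that(1)] img[OF that(2)]
      by (simp add: \<psi>_def map_word_inverse K.word_value_append K.word_value_word_inverse del: set_map)
    then show ?thesis
      using img[OF that(1)] img[OF that(2)] K.word_value_closed unfolding \<psi>_def
      by (metis K.inv_closed K.inv_equality K.inv_inv)
  qed
  define word where "word a = (SOME w. fst ` set w \<subseteq> B \<and> word_value F w = a)" for a
  have word: "fst ` set (word a) \<subseteq> B" "word_value F (word a) = a" if "a \<in> carrier F" for a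
    using someI_ex[OF F.generate_eq_word_values[OF BF, of a]] that unfolding word_def gen by auto
  define \<Phi> where "\<Phi> a = \<psi> (word a)" for a
  have "\<Phi> \<in> hom F K"
  proof (rule homI)
    show "\<Phi> a \<in> carrier K" if "a \<in> carrier F" for a
      using img word that by (simp add: \<Phi>_def \<psi>_def del: set_map)
    show "\<Phi> (a \<otimes>\<^bsub>F\<^esub> b) = \<Phi> a \<otimes>\<^bsub>K\<^esub> \<Phi> b" if "a \<in> carrier F" "b \<in> carrier F" for a b
    proof -
      have "\<Phi> (a \<otimes>\<^bsub>F\<^esub> b) = \<psi> (word a @ word b)"
        unfolding \<Phi>_def using word that sub
        by (intro wd) (auto simp: F.word_value_append image_Un)
      also have "\<dots> = \<Phi> a \<otimes>\<^bsub>K\<^esub> \<Phi> b"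
        using img[OF word(1)[OF that(1)]] img[OF word(1)[OF that(2)]]
        by (simp add: \<Phi>_def \<psi>_def K.word_value_append del: set_map)
      finally show ?thesis .
    qed
  qed
  moreover have "\<Phi> b = \<phi> b" if "b \<in> B" for b
  proof -
    have "\<Phi> b = \<psi> [(b, True)]"
      unfolding \<Phi>_def using that word BF by (intro wd) auto
    then show ?thesis using that K(2) by (simp add: \<psi>_def Pi_iff)
  qed
  ultimately show ?thesis by blast
qed

text \<open>
  Homomorphisms to the additive group of a ring, as plain functions.
\<close>

definition additive_on :: "('g, 'm) monoid_scheme \<Rightarrow> ('g \<Rightarrow> 'r::comm_ring_1) \<Rightarrow> bool" where
  "additive_on G f \<longleftrightarrow> (\<forall>x\<in>carrier G. \<forall>y\<in>carrier G. f (x \<otimes>\<^bsub>G\<^esub> y) = f x + f y)"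

lemma additive_on_one:
  assumes "group G" "additive_on G f"
  shows "f \<one>\<^bsub>G\<^esub> = 0"
proof -
  interpret group G by fact
  have "f (\<one>\<^bsub>G\<^esub> \<otimes>\<^bsub>G\<^esub> \<one>\<^bsub>G\<^esub>) = f \<one>\<^bsub>G\<^esub> + f \<one>\<^bsub>G\<^esub>"
    using assms(2) one_closed unfolding additive_on_def by blast
  then show ?thesis by simp
qed

lemma additive_on_inv:
  assumes "group G" "additive_on G f" "x \<in> carrier G"
  shows "f (inv\<^bsub>G\<^esub> x) = - f x"
proof -
  interpret group G by fact
  have "f (inv\<^bsub>G\<^esub> x \<otimes>\<^bsub>G\<^esub> x) = f (inv\<^bsub>G\<^esub> x) + f x"
    using assms(2,3) inv_closed unfolding additive_on_def by blast
  then show ?thesis 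
    using assms additive_on_one[OF assms(1,2)] by (simp add: eq_neg_iff_add_eq_0)
qed

lemma additive_on_generate_unique:
  assumes G: "group G" "B \<subseteq> carrier G" and f: "additive_on G f" "additive_on G g"
    and eq: "\<And>b. b \<in> B \<Longrightarrow> f b = g b" and a: "a \<in> generate G B"
  shows "f a = g a"
  using a
proof (induction rule: generate.induct)
  case (eng h1 h2)
  then show ?case using G f group.generate_in_carrier[OF G]  by (simp add: additive_on_def)
next
  case (inv h)
  then show ?case using G f eq by (auto simp: additive_on_inv subset_iff)
next
  case one
  show ?case using additive_on_one[OF G(1)] f by metis
next
  case (incl h)
  then show ?case by (rule eq)
qed

text \<open>
  The triple \<open>(a, b, c)\<close> is the unipotent matrix with \<open>a\<close> and \<open>b\<close> above the diagonal and \<open>c\<close> in the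
  corner.
\<close>

definition Heisenberg :: "('r::comm_ring_1 \<times> 'r \<times> 'r) monoid" where
  "Heisenberg = \<lparr>carrier = UNIV,
     monoid.mult = (\<lambda>(a, b, c) (a', b', c'). (a + a', b + b', c + c' + a * b')),
     one = (0, 0, 0)\<rparr>"

lemma group_Heisenberg: "group (Heisenberg :: ('r::comm_ring_1 \<times> 'r \<times> 'r) monoid)"
proof (rule groupI)
  fix x :: "'r \<times> 'r \<times> 'r"
  show "\<exists>y\<in>carrier Heisenberg. y \<otimes>\<^bsub>Heisenberg\<^esub> x = \<one>\<^bsub>Heisenberg\<^esub>"
    by (intro bexI[of _ "(- fst x, - fst (snd x), - snd (snd x) + fst x * fst (snd x))"])
      (auto simp: Heisenberg_def case_prod_unfold)
qed (auto simp: Heisenberg_def algebra_simps)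

lemma free_basis_extend_additive:
  fixes \<phi> :: "'g \<Rightarrow> 'r::comm_ring_1"
  assumes "group F" "free_basis F B"
  shows "\<exists>f. additive_on F f \<and> (\<forall>b\<in>B. f b = \<phi> b)"
proof -
  obtain \<Phi> where "\<Phi> \<in> hom F Heisenberg" "\<forall>b\<in>B. \<Phi> b = (\<phi> b, 0, 0)"
    using free_basis_extend_hom[OF assms group_Heisenberg, of "\<lambda>b. (\<phi> b, 0, 0)"]
    by (auto simp: Heisenberg_def)
  then show ?thesis
    by (intro exI[of _ "fst \<circ> \<Phi>"])
      (auto simp: additive_on_def hom_mult Heisenberg_def case_prod_unfold)
qed

text \<open>
  The group-cohomological form of the vanishing of cup products on a free group. The map
  \<open>b \<mapsto> (f b, g b, 0)\<close> extends from the basis to a homomorphism to the Heisenberg group. Its first two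
  coordinates are additive, hence are \<open>f\<close> and \<open>g\<close>, and its third coordinate is \<open>h\<close>.
\<close>

lemma free_basis_product_primitive:
  fixes f g :: "'g \<Rightarrow> 'r::comm_ring_1"
  assumes F: "group F" "free_basis F B" and f: "additive_on F f" and g: "additive_on F g"
  shows "\<exists>h. \<forall>x\<in>carrier F. \<forall>y\<in>carrier F. h (x \<otimes>\<^bsub>F\<^esub> y) = h x + h y + f x * g y"
proof -
  interpret F: group F by fact
  have BF: "B \<subseteq> carrier F" and gen: "generate F B = carrier F"
    using F by (auto simp: free_basis_def)
  obtain \<Phi> where \<Phi>: "\<Phi> \<in> hom F Heisenberg" and base: "\<And>b. b \<in> B \<Longrightarrow> \<Phi> b = (f b, g b, 0)"
    using free_basis_extend_hom[OF F group_Heisenberg, of "\<lambda>b. (f b, g b, 0)"]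
    by (auto simp: Heisenberg_def)
  define h where "h x = snd (snd (\<Phi> x))" for x
  have mult: "\<Phi> (x \<otimes>\<^bsub>F\<^esub> y) = (fst (\<Phi> x) + fst (\<Phi> y), fst (snd (\<Phi> x)) + fst (snd (\<Phi> y)),
      h x + h y + fst (\<Phi> x) * fst (snd (\<Phi> y)))" if "x \<in> carrier F" "y \<in> carrier F" for x y
    using hom_mult[OF \<Phi> that] by (simp add: Heisenberg_def case_prod_unfold h_def)
  have 1: "fst (\<Phi> x) = f x" if "x \<in> carrier F" for x
    using additive_on_generate_unique[OF F(1) BF _ f, of "\<lambda>x. fst (\<Phi> x)"] that gen mult base
    by (auto simp: additive_on_def)
  have 2: "fst (snd (\<Phi> x)) = g x" if "x \<in> carrier F" for x
    using additive_on_generate_unique[OF F(1) BF _ g, of "\<lambda>x. fst (snd (\<Phi> x))"] that gen mult base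
    by (auto simp: additive_on_def)
  have h: "h (x \<otimes>\<^bsub>F\<^esub> y) = h x + h y + f x * g y" if "x \<in> carrier F" "y \<in> carrier F" for x y
    using mult[OF that] 1 2 that by (simp add: h_def)
  then show ?thesis by blast
qed

section \<open>Homotopy of paths relative to their end points\<close>

text \<open>
  For loops at \<open>x0\<close> this is the relation that defines the fundamental group.
\<close>

definition homotopic_rel_ends :: "'a topology \<Rightarrow> (real \<Rightarrow> 'a) \<Rightarrow> (real \<Rightarrow> 'a) \<Rightarrow> bool" where
  "homotopic_rel_ends T p q \<longleftrightarrow>
     homotopic_with (\<lambda>g. g 0 = p 0 \<and> g 1 = p 1) (top_of_set {0..1}) T p q"

lemma homotopic_rel_ends_imp:
  assumes "homotopic_rel_ends T p q"
  shows "pathin T p" "pathin T q" "q 0 = p 0" "q 1 = p 1"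
  using homotopic_with_imp_continuous_maps[OF assms[unfolded homotopic_rel_ends_def]]
    homotopic_with_imp_property[OF assms[unfolded homotopic_rel_ends_def]]
  by (auto simp: pathin_def)

lemma homotopic_rel_ends_refl: "pathin T p \<Longrightarrow> homotopic_rel_ends T p p"
  by (simp add: homotopic_rel_ends_def pathin_def)

lemma homotopic_rel_ends_sym: "homotopic_rel_ends T p q \<Longrightarrow> homotopic_rel_ends T q p"
  using homotopic_rel_ends_imp[of T p q]
  unfolding homotopic_rel_ends_def by (auto intro: homotopic_with_symD)

lemma homotopic_rel_ends_trans [trans]:
  "homotopic_rel_ends T p q \<Longrightarrow> homotopic_rel_ends T q r \<Longrightarrow> homotopic_rel_ends T p r"
  using homotopic_rel_ends_imp[of T p q]
  unfolding homotopic_rel_ends_def by (auto intro: homotopic_with_trans)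

text \<open>
  The straight line between two paths in a convex set, mapped into the space. Reparametrizations and
  the homotopy across a triangle are both obtained in this way. Convex sets live in \<open>nat \<Rightarrow> real\<close> so that standard simplices are covered.
\<close>

lemma homotopic_rel_ends_convex:
  fixes f :: "(nat \<Rightarrow> real) \<Rightarrow> 'a"
  assumes f: "continuous_map (subtopology (powertop_real UNIV) S) T f"
    and conv: "\<And>x y u. \<lbrakk>x \<in> S; y \<in> S; 0 \<le> u; u \<le> 1\<rbrakk> \<Longrightarrow> (\<lambda>i. (1 - u) * x i + u * y i) \<in> S"
    and a: "\<And>t. t \<in> {0..1} \<Longrightarrow> \<alpha> t \<in> S" "\<And>i. continuous_on {0..1} (\<lambda>t. \<alpha> t i)"
    and b: "\<And>t. t \<in> {0..1} \<Longrightarrow> \<beta> t \<in> S" "\<And>i. continuous_on {0..1} (\<lambda>t. \<beta> t i)"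
    and ends: "\<alpha> 0 = \<beta> 0" "\<alpha> 1 = \<beta> 1"
  shows "homotopic_rel_ends T (\<lambda>t. f (\<alpha> t)) (\<lambda>t. f (\<beta> t))"
proof -
  let ?I = "top_of_set {0..1::real}"
  let ?h = "\<lambda>(u, t) i. (1 - u) * \<alpha> t i + u * \<beta> t i"
  have snd: "continuous_map (prod_topology ?I ?I) euclideanreal (\<lambda>z. g (snd z))"
    if "continuous_on {0..1} g" for g :: "real \<Rightarrow> real"
    using continuous_map_compose[OF continuous_map_snd[of ?I ?I], of euclideanreal g] that
    by (simp add: comp_def)
  have fst: "continuous_map (prod_topology ?I ?I) euclideanreal fst"
    using continuous_map_fst[of ?I ?I] by (simp add: continuous_map_in_subtopology)
  have "continuous_map (prod_topology ?I ?I) (powertop_real UNIV) ?h"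
    unfolding continuous_map_componentwise_UNIV case_prod_unfold
    by (intro allI continuous_intros fst snd a b)
  then have "continuous_map (prod_topology ?I ?I) (subtopology (powertop_real UNIV) S) ?h"
    by (auto simp: continuous_map_in_subtopology a b conv)
  then have "continuous_map (prod_topology ?I ?I) T (f \<circ> ?h)"
    using f by (rule continuous_map_compose)
  then show ?thesis
    unfolding homotopic_rel_ends_def homotopic_with_def
    by (intro exI[of _ "f \<circ> ?h"]) (auto simp: ends algebra_simps)
qed

text \<open>
  The unit, inverse and associativity laws are instances, because in each of them both sides are
  reparametrizations of one path.
\<close>

lemma homotopic_rel_ends_reparametrize:
  fixes f g :: "real \<Rightarrow> real"
  assumes p: "pathin T p"
    and f: "continuous_on {0..1} f" "\<And>t. t \<in> {0..1} \<Longrightarrow> f t \<in> {0..1}"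
    and g: "continuous_on {0..1} g" "\<And>t. t \<in> {0..1} \<Longrightarrow> g t \<in> {0..1}"
    and ends: "f 0 = g 0" "f 1 = g 1"
  shows "homotopic_rel_ends T (\<lambda>t. p (f t)) (\<lambda>t. p (g t))"
proof -
  \<comment> \<open>The unit interval, as the first coordinate of a convex set of sequences.\<close>
  let ?S = "{x :: nat \<Rightarrow> real. x 0 \<in> {0..1}}"
  have "continuous_map (subtopology (powertop_real UNIV) ?S) (top_of_set {0..1}) (\<lambda>x. x 0)"
    by (auto simp: continuous_map_in_subtopology
        intro!: continuous_map_from_subtopology continuous_map_product_projection)
  from continuous_map_compose[OF this p[unfolded pathin_def]]
  have "continuous_map (subtopology (powertop_real UNIV) ?S) T (\<lambda>x. p (x 0))"
    by (simp add: comp_def)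
  then show ?thesis
    by (rule homotopic_rel_ends_convex[where \<alpha> = "\<lambda>t i. f t" and \<beta> = "\<lambda>t i. g t"])
      (use f g ends in \<open>auto simp: convex_bound_le\<close>)
qed

lemma pathin_reparametrize:
  assumes "pathin T p" "continuous_on {0..1} f" "\<And>t. t \<in> {0..1} \<Longrightarrow> f t \<in> {0..1}"
  shows "pathin T (\<lambda>t. p (f t))"
  using homotopic_rel_ends_imp(1)[OF homotopic_rel_ends_reparametrize[OF assms assms(2,3)]] by simp

lemma loop_join_ends [simp]: "loop_join p q 0 = p 0" "loop_join p q 1 = q 1"
  by (auto simp: loop_join_def)

lemma homotopic_rel_ends_join:
  assumes "homotopic_rel_ends T p p'" "homotopic_rel_ends T q q'" "p 1 = q 0"
  shows "homotopic_rel_ends T (loop_join p q) (loop_join p' q')"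
proof -
  let ?I = "top_of_set {0..1::real}"
  obtain h where h: "continuous_map (prod_topology ?I ?I) T h"
      "\<And>t. h (0, t) = p t" "\<And>t. h (1, t) = p' t" 
      "\<And>s. s \<in> {0..1} \<Longrightarrow> h (s, 0) = p 0 \<and> h (s, 1) = p 1"
    using assms(1) unfolding homotopic_rel_ends_def homotopic_with_def by blast
  obtain k where k: "continuous_map (prod_topology ?I ?I) T k"
      "\<And>t. k (0, t) = q t" "\<And>t. k (1, t) = q' t" 
      "\<And>s. s \<in> {0..1} \<Longrightarrow> k (s, 0) = q 0 \<and> k (s, 1) = q 1"
    using assms(2) unfolding homotopic_rel_ends_def homotopic_with_def by blast
  let ?l = "\<lambda>z. if snd z \<le> 1/2 then (h \<circ> (\<lambda>z. (fst z, 2 * snd z))) z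
                 else (k \<circ> (\<lambda>z. (fst z, 2 * snd z - 1))) z"
  have eu: "prod_topology ?I ?I = top_of_set ({0..1} \<times> {0..1})"
    by simp
  have "continuous_map (prod_topology ?I ?I) T ?l"
  proof (intro continuous_map_cases_le continuous_map_compose[OF _ h(1)] continuous_map_compose[OF _ k(1)])
    show "continuous_map (prod_topology ?I ?I) euclideanreal snd"
      unfolding eu by (simp add: continuous_on_snd)
    show "continuous_map (subtopology (prod_topology ?I ?I)
        {z \<in> topspace (prod_topology ?I ?I). snd z \<le> 1/2}) (prod_topology ?I ?I)
        (\<lambda>z. (fst z, 2 * snd z))"
      unfolding eu subtopology_subtopology
      by (auto intro!: continuous_intros)
    show "continuous_map (subtopology (prod_topology ?I ?I)
        {z \<in> topspace (prod_topology ?I ?I). 1/2 \<le> snd z}) (prod_topology ?I ?I)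
        (\<lambda>z. (fst z, 2 * snd z - 1))"
      unfolding eu subtopology_subtopology
      by (auto intro!: continuous_intros)
    show "(h \<circ> (\<lambda>z. (fst z, 2 * snd z))) z = (k \<circ> (\<lambda>z. (fst z, 2 * snd z - 1))) z"
      if "z \<in> topspace (prod_topology ?I ?I)" "snd z = 1/2" for z
    proof -
      have "fst z \<in> {0..1}" "2 * snd z = 1"
        using that by auto
      then show ?thesis
        using h(4)[of "fst z"] k(4)[of "fst z"] assms(3) by simp
    qed
  qed auto
  then show ?thesis
    unfolding homotopic_rel_ends_def homotopic_with_def
    by (intro exI[of _ ?l]) (use h k in \<open>auto simp: loop_join_def\<close>)
qed

lemma pathin_join: "\<lbrakk>pathin T p; pathin T q; p 1 = q 0\<rbrakk> \<Longrightarrow> pathin T (loop_join p q)"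
  using homotopic_rel_ends_imp(1) homotopic_rel_ends_join homotopic_rel_ends_refl by metis

definition reverse_path :: "(real \<Rightarrow> 'a) \<Rightarrow> real \<Rightarrow> 'a" where
  "reverse_path p t = p (1 - t)"

lemma reverse_path_ends [simp]: "reverse_path p 0 = p 1" "reverse_path p 1 = p 0"
  by (auto simp: reverse_path_def)

lemma pathin_reverse: "pathin T p \<Longrightarrow> pathin T (reverse_path p)"
  unfolding reverse_path_def[abs_def] by (rule pathin_reparametrize) (auto intro!: continuous_intros)

lemma homotopic_rel_ends_assoc:
  assumes "pathin T p" "pathin T q" "pathin T r" "p 1 = q 0" "q 1 = r 0"
  shows "homotopic_rel_ends T (loop_join (loop_join p q) r) (loop_join p (loop_join q r))"
proof -
  let ?j = "loop_join p (loop_join q r)"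
  \<comment> \<open>The concave piecewise linear map with slopes 2, 1 and 1/2 that takes 1/4 and 1/2 to 1/2 and 3/4.\<close>
  let ?f = "\<lambda>t :: real. min (2 * t) (min (t + 1/4) ((t + 1) / 2))"
  have "homotopic_rel_ends T (\<lambda>t. ?j (?f t)) (\<lambda>t. ?j t)"
    by (rule homotopic_rel_ends_reparametrize)
      (use assms in \<open>auto simp: min_le_iff_disj intro!: pathin_join continuous_intros\<close>)
  moreover have "loop_join (loop_join p q) r t = ?j (?f t)" for t
  proof -
    consider "t \<le> 1/4" "?f t = 2 * t" | "1/4 < t" "t \<le> 1/2" "?f t = t + 1/4" | "1/2 < t" "?f t = (t + 1) / 2"
    proof -
      have 1: "?f t = 2 * t" if "t \<le> 1/4"
        using that by (auto simp: min_def)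
      have 2: "?f t = t + 1/4" if "1/4 < t" "t \<le> 1/2"
        using that by (auto simp: min_def)
      have 3: "?f t = (t + 1) / 2" if "1/2 < t"
        using that by (auto simp: min_def)
      show thesis
      proof (cases "t \<le> 1/4")
        case True
        with 1 that(1) show thesis by blast
      next
        case False
        with 2 3 that(2,3) show thesis by (cases "t \<le> 1/2") auto
      qed
    qed
    then show ?thesis
    proof cases
      case 1
      then have "2 * t \<le> 1/2" "t \<le> 1/2" by linarith+
      then show ?thesis unfolding 1(2) by (simp add: loop_join_def)
    next
      case 2
      have "2 * (2 * t) - 1 = 2 * (2 * (t + 1/4) - 1)" by simp
      with 2(1,2) show ?thesis unfolding 2(3) by (simp add: loop_join_def)
    next
      case 3
      have "2 * t - 1 = 2 * (2 * ((t + 1) / 2) - 1) - 1" by (simp add: field_simps)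
      with 3(1) show ?thesis unfolding 3(2) by (simp add: loop_join_def)
    qed
  qed
  then have "loop_join (loop_join p q) r = (\<lambda>t. ?j (?f t))"
    by (rule ext)
  ultimately show ?thesis by (simp only:)
qed

lemma homotopic_rel_ends_left_unit:
  assumes "pathin T p"
  shows "homotopic_rel_ends T (loop_join (\<lambda>_. p 0) p) p"
proof -
  have "homotopic_rel_ends T (\<lambda>t. p (max 0 (2 * t - 1))) (\<lambda>t. p t)"
    by (rule homotopic_rel_ends_reparametrize) (use assms in \<open>auto intro!: continuous_intros\<close>)
  moreover have "loop_join (\<lambda>_. p 0) p = (\<lambda>t. p (max 0 (2 * t - 1)))"
  proof (rule ext)
    show "loop_join (\<lambda>_. p 0) p t = p (max 0 (2 * t - 1))" for t
      by (cases "t = 1/2") (unfold loop_join_def, auto simp: max_def simp del: eq_divide_eq_numeral1)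
  qed
  ultimately show ?thesis by simp
qed

lemma homotopic_rel_ends_right_unit:
  assumes "pathin T p"
  shows "homotopic_rel_ends T (loop_join p (\<lambda>_. p 1)) p"
proof -
  have "homotopic_rel_ends T (\<lambda>t. p (min 1 (2 * t))) (\<lambda>t. p t)"
    by (rule homotopic_rel_ends_reparametrize) (use assms in \<open>auto intro!: continuous_intros\<close>)
  moreover have "loop_join p (\<lambda>_. p 1) = (\<lambda>t. p (min 1 (2 * t)))"
  proof (rule ext)
    show "loop_join p (\<lambda>_. p 1) t = p (min 1 (2 * t))" for t
      by (cases "t = 1/2") (unfold loop_join_def, auto simp: min_def simp del: eq_divide_eq_numeral1)
  qed
  ultimately show ?thesis by simp
qed

lemma homotopic_rel_ends_left_inverse:
  assumes "pathin T p"
  shows "homotopic_rel_ends T (loop_join (reverse_path p) p) (\<lambda>_. p 1)"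
proof -
  have "homotopic_rel_ends T (\<lambda>t. p \<bar>2 * t - 1\<bar>) (\<lambda>t. p 1)"
    by (rule homotopic_rel_ends_reparametrize) (use assms in \<open>auto intro!: continuous_intros\<close>)
  moreover have "loop_join (reverse_path p) p = (\<lambda>t. p \<bar>2 * t - 1\<bar>)"
  proof (rule ext)
    show "loop_join (reverse_path p) p t = p \<bar>2 * t - 1\<bar>" for t
      by (cases "t = 1/2") (unfold loop_join_def reverse_path_def, auto simp: abs_real_def simp del: eq_divide_eq_numeral1)
  qed
  ultimately show ?thesis by simp
qed

text \<open>
  Consecutive loops that are closed up by the same path \<open>g\<close>, once backwards and once forwards, can
  be spliced. This is what makes the labels of two consecutive edges multiply.
\<close>

lemma homotopic_rel_ends_telescope:
  assumes p: "pathin T p" and q: "pathin T q" and r: "pathin T r" and s: "pathin T s"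
    and g: "pathin T g"
    and ends: "p 1 = q 0" "q 1 = g 1" "g 1 = r 0" "r 1 = s 0"
  shows "homotopic_rel_ends T
    (loop_join (loop_join (loop_join p q) (reverse_path g)) (loop_join (loop_join g r) s))
    (loop_join (loop_join p (loop_join q r)) s)"
proof -
  note [simp] = assms pathin_join pathin_reverse
  have "homotopic_rel_ends T (loop_join (reverse_path g) (loop_join g r))
      (loop_join (loop_join (reverse_path g) g) r)"
    by (rule homotopic_rel_ends_sym, rule homotopic_rel_ends_assoc) simp_all
  also have "homotopic_rel_ends T \<dots> (loop_join (\<lambda>_. r 0) r)"
    using homotopic_rel_ends_left_inverse[OF g]
    by (intro homotopic_rel_ends_join homotopic_rel_ends_refl) simp_all
  also have "homotopic_rel_ends T \<dots> r"
    by (rule homotopic_rel_ends_left_unit) simp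
  finally have cancel: "homotopic_rel_ends T (loop_join (reverse_path g) (loop_join g r)) r" .
  have "homotopic_rel_ends T
    (loop_join (loop_join (loop_join p q) (reverse_path g)) (loop_join (loop_join g r) s))
    (loop_join (loop_join p q) (loop_join (reverse_path g) (loop_join (loop_join g r) s)))"
    by (rule homotopic_rel_ends_assoc) simp_all
  also have "homotopic_rel_ends T \<dots>
    (loop_join (loop_join p q) (loop_join (loop_join (reverse_path g) (loop_join g r)) s))"
    by (intro homotopic_rel_ends_join homotopic_rel_ends_refl
        homotopic_rel_ends_sym[OF homotopic_rel_ends_assoc]) simp_all
  also have "homotopic_rel_ends T \<dots> (loop_join (loop_join p q) (loop_join r s))"
    by (intro homotopic_rel_ends_join homotopic_rel_ends_refl cancel) simp_all
  also have "homotopic_rel_ends T \<dots> (loop_join (loop_join (loop_join p q) r) s)"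
    by (intro homotopic_rel_ends_sym[OF homotopic_rel_ends_assoc]) simp_all
  also have "homotopic_rel_ends T \<dots> (loop_join (loop_join p (loop_join q r)) s)"
    by (intro homotopic_rel_ends_join homotopic_rel_ends_refl homotopic_rel_ends_assoc) simp_all
  finally show ?thesis .
qed


lemma homotopic_rel_ends_eq:
  assumes "pathin T p" "\<And>t. t \<in> {0..1} \<Longrightarrow> p t = q t"
  shows "homotopic_rel_ends T p q"
  unfolding homotopic_rel_ends_def
  by (rule homotopic_with_equal) (use assms in \<open>auto simp: pathin_def\<close>)

section \<open>Labelling the edges of a space by its fundamental group\<close>

text \<open>
  The standard 1-simplex, run through from its vertex 0 to its vertex 1.
\<close>

definition edge_path :: "((nat \<Rightarrow> real) \<Rightarrow> 'a) \<Rightarrow> real \<Rightarrow> 'a" where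
  "edge_path \<sigma> t = \<sigma> (\<lambda>i. if i = 0 then 1 - t else if i = 1 then t else 0)"

definition path_simplex :: "(real \<Rightarrow> 'a) \<Rightarrow> (nat \<Rightarrow> real) \<Rightarrow> 'a" where
  "path_simplex p = restrict (\<lambda>x. p (x 1)) (standard_simplex 1)"

lemma edge_in_standard_simplex:
  "t \<in> {0..1} \<Longrightarrow> (\<lambda>i. if i = 0 then 1 - t else if i = 1 then t else 0) \<in> standard_simplex 1"
  by (auto simp: standard_simplex_def)

lemma pathin_edge_path:
  assumes "singular_simplex 1 T \<sigma>"
  shows "pathin T (edge_path \<sigma>)"
proof -
  let ?\<alpha> = "\<lambda>(t::real) (i::nat). if i = 0 then 1 - t else if i = 1 then t else 0"
  have "homotopic_rel_ends T (\<lambda>t. \<sigma> (?\<alpha> t)) (\<lambda>t. \<sigma> (?\<alpha> t))"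
  proof (rule homotopic_rel_ends_convex)
    show "continuous_map (subtopology (powertop_real UNIV) (standard_simplex 1)) T \<sigma>"
      using assms by (simp add: singular_simplex_def)
    show "continuous_on {0..1} (\<lambda>t. ?\<alpha> t i)" for i
      by (cases "i = 0"; cases "i = 1") (auto intro!: continuous_intros)
    then show "continuous_on {0..1} (\<lambda>t. ?\<alpha> t i)" for i .
    show "?\<alpha> t \<in> standard_simplex 1" if "t \<in> {0..1}" for t
      by (rule edge_in_standard_simplex) fact
    show "?\<alpha> t \<in> standard_simplex 1" if "t \<in> {0..1}" for t
      by (rule edge_in_standard_simplex) fact
  qed (simp_all add: convex_standard_simplex)
  then show ?thesis
    by (auto simp: edge_path_def[abs_def] dest: homotopic_rel_ends_imp(1))
qed

lemma singular_simplex_path_simplex: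
  assumes "pathin T p"
  shows "singular_simplex 1 T (path_simplex p)"
proof -
  have "continuous_map (subtopology (powertop_real UNIV) (standard_simplex 1)) (top_of_set {0..1})
      (\<lambda>x. x 1)"
    by (auto simp: continuous_map_in_subtopology standard_simplex_def
        intro!: continuous_map_from_subtopology continuous_map_product_projection)
  from continuous_map_compose[OF this assms[unfolded pathin_def]]
  have "continuous_map (subtopology (powertop_real UNIV) (standard_simplex 1)) T (\<lambda>x. p (x 1))"
    by (simp add: comp_def)
  then have "continuous_map (subtopology (powertop_real UNIV) (standard_simplex 1)) T (path_simplex p)"
    by (rule continuous_map_eq) (simp add: path_simplex_def)
  then show ?thesis
    by (simp add: singular_simplex_def path_simplex_def)
qed

lemma edge_path_path_simplex: "t \<in> {0..1} \<Longrightarrow> edge_path (path_simplex p) t = p t"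
  using edge_in_standard_simplex[of t] by (simp add: edge_path_def path_simplex_def)

lemma edge_path_singular_face:
  "t \<in> {0..1} \<Longrightarrow> edge_path (singular_face 2 k \<sigma>) t =
     \<sigma> (simplical_face k (\<lambda>i. if i = 0 then 1 - t else if i = 1 then t else 0))"
  using edge_in_standard_simplex[of t] by (simp add: edge_path_def singular_face_def)

lemma edge_path_face_ends:
  "edge_path (singular_face 2 (Suc 0) \<sigma>) 0 = edge_path (singular_face 2 2 \<sigma>) 0"
  "edge_path (singular_face 2 0 \<sigma>) 0 = edge_path (singular_face 2 2 \<sigma>) 1"
  "edge_path (singular_face 2 (Suc 0) \<sigma>) 1 = edge_path (singular_face 2 0 \<sigma>) 1"
  by (auto simp: edge_path_singular_face simplical_face_def fun_eq_iff intro!: arg_cong[of _ _ \<sigma>])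

text \<open>
  The standard triangle is convex, and both edge paths join its vertices 0 and 2: \<open>\<alpha>\<close> runs
  through the vertex 1, \<open>\<beta>\<close> goes straight.
\<close>

lemma homotopic_edges_of_triangle:
  assumes \<sigma>: "singular_simplex 2 T \<sigma>"
  shows "homotopic_rel_ends T
    (loop_join (edge_path (singular_face 2 2 \<sigma>)) (edge_path (singular_face 2 0 \<sigma>)))
    (edge_path (singular_face 2 (Suc 0) \<sigma>))"
proof -
  let ?e = "\<lambda>k. edge_path (singular_face 2 k \<sigma>)"
  let ?\<alpha> = "\<lambda>(t::real) (i::nat). if i = 0 then max 0 (1 - 2 * t) else
    if i = 1 then min (2 * t) (2 - 2 * t) else if i = 2 then max 0 (2 * t - 1) else 0"
  let ?\<beta> = "\<lambda>(t::real) (i::nat). if i = 0 then 1 - t else if i = 2 then t else 0"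
  have face: "singular_simplex 1 T (singular_face 2 k \<sigma>)" if "k \<le> 2" for k
    using singular_simplex_singular_face[OF \<sigma> _ that] by simp
  have hom: "homotopic_rel_ends T (\<lambda>t. \<sigma> (?\<alpha> t)) (\<lambda>t. \<sigma> (?\<beta> t))"
  proof (rule homotopic_rel_ends_convex)
    show "continuous_map (subtopology (powertop_real UNIV) (standard_simplex 2)) T \<sigma>"
      using \<sigma> by (simp add: singular_simplex_def)
    show "continuous_on {0..1} (\<lambda>t. ?\<alpha> t i)" for i
      by (cases "i = 0"; cases "i = 1"; cases "i = 2") (auto intro!: continuous_intros)
    show "continuous_on {0..1} (\<lambda>t. ?\<beta> t i)" for i
      by (cases "i = 0"; cases "i = 2") (auto intro!: continuous_intros)
    show "?\<alpha> t \<in> standard_simplex 2" if "t \<in> {0..1}" for t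
    proof -
      have "0 \<le> ?\<alpha> t i \<and> ?\<alpha> t i \<le> 1" for i
        using that by (simp add: min_le_iff_disj, linarith)
      moreover have "(\<Sum>i\<le>2. ?\<alpha> t i) = 1"
        by (simp add: numeral_2_eq_2)
      ultimately show ?thesis by (simp add: standard_simplex_def)
    qed
    show "?\<beta> t \<in> standard_simplex 2" if "t \<in> {0..1}" for t
      using that by (auto simp: standard_simplex_def numeral_2_eq_2)
  qed (auto simp: convex_standard_simplex fun_eq_iff)
  have "homotopic_rel_ends T (loop_join (?e 2) (?e 0)) (\<lambda>t. \<sigma> (?\<alpha> t))"
  proof (rule homotopic_rel_ends_eq)
    show "pathin T (loop_join (?e 2) (?e 0))"
      by (intro pathin_join pathin_edge_path face) (simp_all add: edge_path_face_ends)
    show "loop_join (?e 2) (?e 0) t = \<sigma> (?\<alpha> t)" if t: "t \<in> {0..1}" for t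
    proof (cases "t \<le> 1/2")
      case True
      then have "simplical_face 2 (\<lambda>i. if i = 0 then 1 - 2 * t else if i = 1 then 2 * t else 0) = ?\<alpha> t"
        using t by (intro ext) (auto simp: simplical_face_def)
      then show ?thesis
        using True t edge_path_singular_face[of "2 * t" 2 \<sigma>] by (simp add: loop_join_def)
    next
      case False
      then have "simplical_face 0 (\<lambda>i. if i = 0 then 1 - (2 * t - 1) else if i = 1 then 2 * t - 1 else 0) = ?\<alpha> t"
        using t by (intro ext) (auto simp: simplical_face_def)
      then show ?thesis
        using False t edge_path_singular_face[of "2 * t - 1" 0 \<sigma>] by (simp add: loop_join_def)
    qed
  qed
  also note hom
  also have "homotopic_rel_ends T (\<lambda>t. \<sigma> (?\<beta> t)) (?e (Suc 0))"
  proof (rule homotopic_rel_ends_sym, rule homotopic_rel_ends_eq)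
    show "pathin T (?e (Suc 0))"
      by (intro pathin_edge_path face) simp
    show "?e (Suc 0) t = \<sigma> (?\<beta> t)" if "t \<in> {0..1}" for t
      using that
      by (auto simp: edge_path_singular_face simplical_face_def fun_eq_iff intro!: arg_cong[of _ _ \<sigma>])
  qed
  finally show ?thesis .
qed

lemma loop_class_eq:
  assumes "p \<in> loops T x0"
  shows "loop_rel T x0 `` {p} = {q. homotopic_rel_ends T p q}"
  using assms by (auto simp: loop_rel_def loops_def homotopic_rel_ends_def)

lemma loop_class_eqI:
  assumes "p \<in> loops T x0" "homotopic_rel_ends T p q"
  shows "loop_rel T x0 `` {p} = loop_rel T x0 `` {q}"
proof -
  have "q \<in> loops T x0"
    using assms homotopic_rel_ends_imp[OF assms(2)] by (auto simp: loops_def)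
  then show ?thesis
    using assms by (auto simp: loop_class_eq intro: homotopic_rel_ends_sym homotopic_rel_ends_trans)
qed

lemma loop_join_in_loops: "\<lbrakk>p \<in> loops T x0; q \<in> loops T x0\<rbrakk> \<Longrightarrow> loop_join p q \<in> loops T x0"
  by (auto simp: loops_def pathin_join)

lemma fundamental_group_mult:
  assumes p: "p \<in> loops T x0" and q: "q \<in> loops T x0"
  shows "(loop_rel T x0 `` {p}) \<otimes>\<^bsub>fundamental_group T x0\<^esub> (loop_rel T x0 `` {q}) =
    loop_rel T x0 `` {loop_join p q}"
proof -
  have "loop_rel T x0 `` {loop_join p' q'} = loop_rel T x0 `` {loop_join p q}"
    if "homotopic_rel_ends T p p'" "homotopic_rel_ends T q q'" for p' q'
    using that assms loop_join_in_loops[OF p q]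
    by (intro loop_class_eqI[symmetric] homotopic_rel_ends_join) (auto simp: loops_def)
  moreover have "homotopic_rel_ends T p p" "homotopic_rel_ends T q q"
    using assms by (auto simp: loops_def homotopic_rel_ends_refl)
  ultimately have "(\<Union>p'\<in>loop_rel T x0 `` {p}. \<Union>q'\<in>loop_rel T x0 `` {q}.
      loop_rel T x0 `` {loop_join p' q'}) = loop_rel T x0 `` {loop_join p q}"
    unfolding loop_class_eq[OF p] loop_class_eq[OF q] by blast
  then show ?thesis
    by (simp add: fundamental_group_def)
qed

lemma fundamental_group_carrier:
  "A \<in> carrier (fundamental_group T x0) \<longleftrightarrow> (\<exists>p\<in>loops T x0. A = loop_rel T x0 `` {p})"
  by (auto simp: fundamental_group_def quotient_def)

text \<open>
  A nonabelian 1-cocycle: face 0 of a triangle is the edge 12, face 1 is 02, and face 2 is 01.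
\<close>

definition edge_labelling ::
  "'a topology \<Rightarrow> ('g, 'm) monoid_scheme \<Rightarrow> (((nat \<Rightarrow> real) \<Rightarrow> 'a) \<Rightarrow> 'g) \<Rightarrow> bool" where
  "edge_labelling T G \<rho> \<longleftrightarrow>
     (\<forall>\<sigma>. singular_simplex 1 T \<sigma> \<longrightarrow> \<rho> \<sigma> \<in> carrier G) \<and>
     (\<forall>\<sigma>. singular_simplex 2 T \<sigma> \<longrightarrow>
       \<rho> (singular_face 2 (Suc 0) \<sigma>) = \<rho> (singular_face 2 2 \<sigma>) \<otimes>\<^bsub>G\<^esub> \<rho> (singular_face 2 0 \<sigma>))"

lemma edge_labelling_hom:
  assumes \<rho>: "edge_labelling T G \<rho>" and h: "h \<in> hom G F"
  shows "edge_labelling T F (\<lambda>\<sigma>. h (\<rho> \<sigma>))"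
proof -
  have "singular_simplex 1 T (singular_face 2 k \<sigma>)" if "singular_simplex 2 T \<sigma>" "k \<le> 2" for \<sigma> k
    using singular_simplex_singular_face[OF that(1) _ that(2)] by simp
  then show ?thesis
    using \<rho> hom_in_carrier[OF h] hom_mult[OF h] unfolding edge_labelling_def by simp
qed

text \<open>
  Edges outside the path component of the base point get the label \<open>\<one>\<close>; the edges of one triangle
  are all inside or all outside. The chosen path from the base point to itself is constant, so that
  a loop, seen as an edge, is labelled by its own class.
\<close>

lemma exists_edge_labelling:
  fixes T :: "'a topology"
  assumes "x0 \<in> topspace T" "group (fundamental_group T x0)"
  defines "G \<equiv> fundamental_group T x0"
  shows "\<exists>\<rho>. edge_labelling T G \<rho> \<and> (\<forall>p\<in>loops T x0. \<rho> (path_simplex p) = loop_rel T x0 `` {p})"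
proof -
  interpret G: group G using assms by simp
  have const: "pathin T (\<lambda>_. x0)"
    using assms by (simp add: pathin_def)
  have "\<exists>g. pathin T g \<and> g 0 = x0 \<and> g 1 = x \<and> (x = x0 \<longrightarrow> g = (\<lambda>_. x0))"
    if "path_component_of T x0 x" for x
  proof (cases "x = x0")
    case True
    then show ?thesis using const by (intro exI[of _ "\<lambda>_. x0"]) auto
  qed (use that in \<open>auto simp: path_component_of_def\<close>)
  then have "\<exists>\<gamma>. \<forall>x. path_component_of T x0 x \<longrightarrow>
      pathin T (\<gamma> x) \<and> \<gamma> x 0 = x0 \<and> \<gamma> x 1 = x \<and> (x = x0 \<longrightarrow> \<gamma> x = (\<lambda>_. x0))"
    by (intro choice) blast
  then obtain \<gamma> where \<gamma>: "\<And>x. path_component_of T x0 x \<Longrightarrow> pathin T (\<gamma> x)"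
      "\<And>x. path_component_of T x0 x \<Longrightarrow> \<gamma> x 0 = x0" "\<And>x. path_component_of T x0 x \<Longrightarrow> \<gamma> x 1 = x"
    and \<gamma>0: "path_component_of T x0 x0 \<Longrightarrow> \<gamma> x0 = (\<lambda>_. x0)"
    by blast
  have x0: "path_component_of T x0 x0"
    using assms by (simp add: path_component_of_refl)
  \<comment> \<open>The loop that closes up a path with the chosen paths to its two ends.\<close>
  define L where
    "L p = loop_join (loop_join (\<gamma> (p 0)) p) (reverse_path (\<gamma> (p 1)))" for p
  define \<rho> where "\<rho> \<sigma> = (if path_component_of T x0 (edge_path \<sigma> 0)
    then loop_rel T x0 `` {L (edge_path \<sigma>)} else \<one>\<^bsub>G\<^esub>)" for \<sigma>
  have end1: "path_component_of T x0 (p 1)" if "pathin T p" "path_component_of T x0 (p 0)" for p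
  proof -
    have "path_component_of T (p 0) (p 1)"
      using that(1) by (auto simp: path_component_of_def)
    with that(2) show ?thesis by (rule path_component_of_trans)
  qed
  have L: "L p \<in> loops T x0" if p: "pathin T p" "path_component_of T x0 (p 0)" for p
    unfolding L_def loops_def mem_Collect_eq loop_join_ends reverse_path_ends
    by (intro conjI pathin_join pathin_reverse)
      (simp_all only: \<gamma>[OF p(2)] \<gamma>[OF end1[OF p]] p loop_join_ends reverse_path_ends)
  have path: "pathin T (edge_path (singular_face 2 k \<sigma>))"
    if "singular_simplex 2 T \<sigma>" "k \<le> 2" for k \<sigma>
    by (intro pathin_edge_path) (use singular_simplex_singular_face[OF that(1) _ that(2)] in simp)
  have "\<rho> \<sigma> \<in> carrier G" if "singular_simplex 1 T \<sigma>" for \<sigma>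
  proof (cases "path_component_of T x0 (edge_path \<sigma> 0)")
    case True
    then have "L (edge_path \<sigma>) \<in> loops T x0"
      by (intro L pathin_edge_path that)
    then have "loop_rel T x0 `` {L (edge_path \<sigma>)} \<in> carrier G"
      unfolding G_def fundamental_group_carrier by blast
    with True show ?thesis by (simp add: \<rho>_def)
  qed (use G.one_closed in \<open>simp add: \<rho>_def\<close>)
  moreover have "\<rho> (singular_face 2 (Suc 0) \<sigma>) = \<rho> (singular_face 2 2 \<sigma>) \<otimes>\<^bsub>G\<^esub> \<rho> (singular_face 2 0 \<sigma>)"
    if \<sigma>: "singular_simplex 2 T \<sigma>" for \<sigma>
  proof -
    define p q r where "p = edge_path (singular_face 2 2 \<sigma>)" and "q = edge_path (singular_face 2 0 \<sigma>)"
      and "r = edge_path (singular_face 2 (Suc 0) \<sigma>)"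
    have [simp]: "pathin T p" "pathin T q" "pathin T r"
      unfolding p_def q_def r_def by (intro path \<sigma>; simp)+
    have [simp]: "q 0 = p 1" "r 0 = p 0" "r 1 = q 1"
      unfolding p_def q_def r_def by (rule edge_path_face_ends)+
    show ?thesis
    proof (cases "path_component_of T x0 (p 0)")
      case True
      then have p1: "path_component_of T x0 (p 1)" by (simp add: end1)
      then have q1: "path_component_of T x0 (q 1)" using end1[of q] by simp
      note [simp] = \<gamma>[OF True] \<gamma>[OF p1] \<gamma>[OF q1] L p1 True
      have "homotopic_rel_ends T (loop_join (L p) (L q))
          (loop_join (loop_join (\<gamma> (p 0)) (loop_join p q)) (reverse_path (\<gamma> (q 1))))"
        unfolding L_def using homotopic_rel_ends_telescope[of T "\<gamma> (p 0)" p q "reverse_path (\<gamma> (q 1))" "\<gamma> (p 1)"]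
        by (simp add: pathin_reverse)
      also have "homotopic_rel_ends T \<dots> (L r)"
        using homotopic_edges_of_triangle[OF \<sigma>] unfolding L_def
        by (intro homotopic_rel_ends_join homotopic_rel_ends_refl)
          (simp_all add: pathin_reverse homotopic_rel_ends_refl flip: p_def q_def r_def)
      finally have "loop_rel T x0 `` {loop_join (L p) (L q)} = loop_rel T x0 `` {L r}"
        by (intro loop_class_eqI loop_join_in_loops) simp_all
      then show ?thesis
        using fundamental_group_mult[of "L p" T x0 "L q"]
        by (simp add: \<rho>_def G_def flip: p_def q_def r_def)
    next
      case False
      moreover from this have "\<not> path_component_of T x0 (p 1)"
      proof -
        have "path_component_of T (p 0) (p 1)"
          unfolding path_component_of_def by (rule exI[of _ p]) simp
        then have bwd: "path_component_of T (p 1) (p 0)"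
          by (rule path_component_of_sym)
        show ?thesis
          using False path_component_of_trans[OF _ bwd, of x0] by blast
      qed
      ultimately show ?thesis
        by (simp add: \<rho>_def flip: p_def q_def r_def)
    qed
  qed
  moreover have "\<rho> (path_simplex p) = loop_rel T x0 `` {p}" if p: "p \<in> loops T x0" for p
  proof -
    define e where "e = edge_path (path_simplex p)"
    have pp: "pathin T p" "p 0 = x0" "p 1 = x0" using p by (auto simp: loops_def)
    have e: "pathin T e" "e 0 = x0" "e 1 = x0"
      unfolding e_def using pp by (auto simp: edge_path_path_simplex intro!: pathin_edge_path singular_simplex_path_simplex)
    have eL: "L e = loop_join (loop_join (\<lambda>_. e 0) e) (\<lambda>_. e 1)"
      by (simp add: L_def e \<gamma>0 x0 reverse_path_def[abs_def])
    have 1: "homotopic_rel_ends T (L e) (loop_join e (\<lambda>_. e 1))"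
      unfolding eL
      by (intro homotopic_rel_ends_join homotopic_rel_ends_refl homotopic_rel_ends_left_unit)
        (simp_all add: e const \<open>x0 \<in> topspace T\<close>)
    have 2: "homotopic_rel_ends T (loop_join e (\<lambda>_. e 1)) e"
      by (intro homotopic_rel_ends_right_unit) (simp add: e)
    have 3: "homotopic_rel_ends T e p"
      by (intro homotopic_rel_ends_eq) (simp add: e, simp add: e_def edge_path_path_simplex)
    have "homotopic_rel_ends T (L e) p"
      by (rule homotopic_rel_ends_trans[OF 1 homotopic_rel_ends_trans[OF 2 3]])
    moreover have "L e \<in> loops T x0"
      using e x0 by (intro L) simp_all
    ultimately have "loop_rel T x0 `` {L e} = loop_rel T x0 `` {p}"
      by (rule loop_class_eqI[rotated])
    then show ?thesis
      using e x0 by (simp add: \<rho>_def flip: e_def)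
  qed
  ultimately show ?thesis unfolding edge_labelling_def by blast
qed

section \<open>Singular cohomology as a module\<close>

definition cochain_eval :: "('a, 'r::comm_ring_1) cochain \<Rightarrow> 'a chain \<Rightarrow> 'r" where
  "cochain_eval c x = (\<Sum>\<sigma>\<in>Poly_Mapping.keys x. of_int (Poly_Mapping.lookup x \<sigma>) * c \<sigma>)"

lemma cochain_eval_superset:
  assumes "finite S" "Poly_Mapping.keys x \<subseteq> S"
  shows "cochain_eval c x = (\<Sum>\<sigma>\<in>S. of_int (Poly_Mapping.lookup x \<sigma>) * c \<sigma>)"
  unfolding cochain_eval_def
  by (rule sum.mono_neutral_left) (use assms in \<open>auto simp: in_keys_iff\<close>)

lemma cochain_eval_0 [simp]: "cochain_eval c 0 = 0"
  by (simp add: cochain_eval_def)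

lemma cochain_eval_of [simp]: "cochain_eval c (frag_of \<sigma>) = c \<sigma>"
  by (simp add: cochain_eval_def)

lemma cochain_eval_add: "cochain_eval c (x + y) = cochain_eval c x + cochain_eval c y"
proof -
  let ?S = "Poly_Mapping.keys x \<union> Poly_Mapping.keys y"
  have "Poly_Mapping.keys (x + y) \<subseteq> ?S" by (rule keys_add)
  then show ?thesis
    by (simp add: cochain_eval_superset[of ?S] lookup_add distrib_right sum.distrib)
qed

lemma cochain_eval_cmul: "cochain_eval c (frag_cmul k x) = of_int k * cochain_eval c x"
proof -
  have "Poly_Mapping.keys (frag_cmul k x) \<subseteq> Poly_Mapping.keys x" by (rule keys_cmul)
  then show ?thesis
    by (simp add: cochain_eval_superset[of "Poly_Mapping.keys x"] sum_distrib_left mult.assoc)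
qed

lemma cochain_eval_minus: "cochain_eval c (- x) = - cochain_eval c x"
  using cochain_eval_cmul[of c "-1" x] by simp

lemma cochain_eval_diff: "cochain_eval c (x - y) = cochain_eval c x - cochain_eval c y"
  using cochain_eval_add[of c x "- y"] by (simp add: cochain_eval_minus)

lemma cochain_eval_sum: "cochain_eval c (sum f I) = (\<Sum>i\<in>I. cochain_eval c (f i))"
  by (induction I rule: infinite_finite_induct) (auto simp: cochain_eval_add)

lemma cochain_eval_linear:
  "cochain_eval (\<lambda>\<sigma>. \<Sum>b\<in>B. k b * c b \<sigma>) x = (\<Sum>b\<in>B. k b * cochain_eval (c b) x)"
  unfolding cochain_eval_def sum_distrib_left
  by (subst sum.swap) (simp add: mult_ac)

lemma cochain_eval_coboundary:
  assumes "singular_chain (Suc p) T x"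
  shows "cochain_eval (coboundary p T c) x = cochain_eval c (chain_boundary (Suc p) x)"
  using assms unfolding singular_chain_def
proof (induction x rule: frag_induction)
  case (one \<sigma>)
  then show ?case
    by (simp add: chain_boundary_of cochain_eval_sum cochain_eval_cmul coboundary_def
        del: sum.atMost_Suc)
qed (auto simp: cochain_eval_diff chain_boundary_diff)

lemma coboundary_in_cochains: "coboundary p T c \<in> cochains (Suc p) T"
  by (simp add: coboundary_def cochains_def)

text \<open>
  Dual to \<open>chain_boundary_boundary\<close>: evaluate on a single simplex and move both coboundary operators
  to the other side.
\<close>

lemma coboundary_coboundary: "coboundary (Suc p) T (coboundary p T c) = (\<lambda>_. 0)"
proof (rule ext)
  fix \<sigma>
  show "coboundary (Suc p) T (coboundary p T c) \<sigma> = 0"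
  proof (cases "singular_simplex (Suc (Suc p)) T \<sigma>")
    case True
    then have x: "singular_chain (Suc (Suc p)) T (frag_of \<sigma>)" by (simp add: singular_chain_of)
    have "coboundary (Suc p) T (coboundary p T c) \<sigma>
        = cochain_eval c (chain_boundary (Suc p) (chain_boundary (Suc (Suc p)) (frag_of \<sigma>)))"
      using cochain_eval_coboundary[OF x, of "coboundary p T c"]
        cochain_eval_coboundary[OF singular_chain_boundary_alt[OF x], of c] by simp
    also have "\<dots> = 0"
      using chain_boundary_boundary[OF x] by simp
    finally show ?thesis .
  qed (simp add: coboundary_def)
qed

lemma coboundary_add:
  "coboundary p T (\<lambda>\<sigma>. a \<sigma> + b \<sigma>) = (\<lambda>\<sigma>. coboundary p T a \<sigma> + coboundary p T b \<sigma>)"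
  by (auto simp: coboundary_def fun_eq_iff distrib_left sum.distrib simp del: sum.atMost_Suc)

lemma coboundary_scale:
  "coboundary p T (\<lambda>\<sigma>. r * a \<sigma>) = (\<lambda>\<sigma>. r * coboundary p T a \<sigma>)"
  by (auto simp: coboundary_def fun_eq_iff sum_distrib_left mult_ac simp del: sum.atMost_Suc)

lemma coboundary_zero: "coboundary p T (\<lambda>_. 0) = (\<lambda>_. 0)"
  using coboundary_scale[of p T 0 "\<lambda>_. 0"] by simp

lemma cocycles_zero: "(\<lambda>_. 0) \<in> cocycles p T"
  by (simp add: cocycles_def cochains_def coboundary_zero)

lemma cocycles_add: "\<lbrakk>a \<in> cocycles p T; b \<in> cocycles p T\<rbrakk> \<Longrightarrow> (\<lambda>\<sigma>. a \<sigma> + b \<sigma>) \<in> cocycles p T"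
  by (simp add: cocycles_def cochains_def coboundary_add)

lemma cocycles_scale: "a \<in> cocycles p T \<Longrightarrow> (\<lambda>\<sigma>. r * a \<sigma>) \<in> cocycles p T"
  by (simp add: cocycles_def cochains_def coboundary_scale)

lemma cocycles_sum:
  assumes "\<And>b. b \<in> B \<Longrightarrow> a b \<in> cocycles p T"
  shows "(\<lambda>\<sigma>. \<Sum>b\<in>B. a b \<sigma>) \<in> cocycles p T"
  using assms by (induction B rule: infinite_finite_induct) (simp_all add: cocycles_zero cocycles_add)

lemma coboundaries_zero: "(\<lambda>_. 0) \<in> coboundaries p T"
  by (cases p) (auto simp: coboundaries_def cochains_def coboundary_zero intro!: image_eqI[of _ _ "\<lambda>_. 0"])

lemma coboundaries_add:
  assumes "a \<in> coboundaries p T" "b \<in> coboundaries p T"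
  shows "(\<lambda>\<sigma>. a \<sigma> + b \<sigma>) \<in> coboundaries p T"
proof (cases p)
  case (Suc q)
  then obtain u v where "u \<in> cochains q T" "a = coboundary q T u" "v \<in> cochains q T" "b = coboundary q T v"
    using assms by (auto simp: coboundaries_def)
  then show ?thesis
    using Suc by (auto simp: coboundaries_def coboundary_add cochains_def intro!: image_eqI[of _ _ "\<lambda>\<sigma>. u \<sigma> + v \<sigma>"])
qed (use assms in \<open>auto simp: coboundaries_def\<close>)

lemma coboundaries_scale:
  assumes "a \<in> coboundaries p T"
  shows "(\<lambda>\<sigma>. r * a \<sigma>) \<in> coboundaries p T"
proof (cases p)
  case (Suc q)
  then obtain u where "u \<in> cochains q T" "a = coboundary q T u"
    using assms by (auto simp: coboundaries_def)
  then show ?thesis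
    using Suc by (auto simp: coboundaries_def coboundary_scale cochains_def intro!: image_eqI[of _ _ "\<lambda>\<sigma>. r * u \<sigma>"])
qed (use assms in \<open>auto simp: coboundaries_def\<close>)

lemma coboundaries_subset_cocycles: "coboundaries p T \<subseteq> cocycles p T"
proof (cases p)
  case 0
  then show ?thesis by (auto simp: coboundaries_def cocycles_zero)
next
  case (Suc q)
  then show ?thesis
    using coboundary_in_cochains by (auto simp: coboundaries_def cocycles_def coboundary_coboundary)
qed

abbreviation cohomology_class ::
  "nat \<Rightarrow> 'a topology \<Rightarrow> ('a, 'r::comm_ring_1) cochain \<Rightarrow> ('a, 'r) cochain set" where
  "cohomology_class p T a \<equiv> cohomologous p T `` {a}"

lemma equiv_cohomologous: "equiv (cocycles p T) (cohomologous p T)"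
proof (rule equivI)
  show "refl_on (cocycles p T) (cohomologous p T)"
    by (auto simp: refl_on_def cohomologous_def coboundaries_zero)
  show "sym (cohomologous p T)"
    using coboundaries_scale[of _ p T "-1"] by (fastforce simp: sym_def cohomologous_def)
  show "trans (cohomologous p T)"
    using coboundaries_add[of _ p T] by (fastforce simp: trans_def cohomologous_def)
qed (auto simp: cohomologous_def)

lemma cohomology_class_eq_iff:
  assumes "a \<in> cocycles p T" "b \<in> cocycles p T"
  shows "cohomology_class p T a = cohomology_class p T b \<longleftrightarrow> (\<lambda>\<sigma>. a \<sigma> - b \<sigma>) \<in> coboundaries p T"
  using eq_equiv_class_iff[OF equiv_cohomologous assms] assms by (simp add: cohomologous_def)

lemma cohomology_class_eq_zero_iff:
  assumes "a \<in> cocycles p T"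
  shows "cohomology_class p T a = \<zero>\<^bsub>cohomology p T\<^esub> \<longleftrightarrow> a \<in> coboundaries p T"
  using cohomology_class_eq_iff[OF assms cocycles_zero] by (simp add: cohomology_def)

lemma cohomology_class_in_carrier: "a \<in> cocycles p T \<Longrightarrow> cohomology_class p T a \<in> carrier (cohomology p T)"
  by (simp add: cohomology_def quotientI)

lemma cohomology_carrierE:
  assumes "A \<in> carrier (cohomology p T)"
  obtains a where "a \<in> cocycles p T" "A = cohomology_class p T a"
  using assms by (auto simp: cohomology_def quotient_def)

lemma cohomology_add_class:
  assumes a: "a \<in> cocycles p T" and b: "b \<in> cocycles p T"
  shows "cohomology_class p T a \<oplus>\<^bsub>cohomology p T\<^esub> cohomology_class p T b =
    cohomology_class p T (\<lambda>\<sigma>. a \<sigma> + b \<sigma>)"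
proof -
  have "cohomology_class p T (\<lambda>\<sigma>. a' \<sigma> + b' \<sigma>) = cohomology_class p T (\<lambda>\<sigma>. a \<sigma> + b \<sigma>)"
    if "a' \<in> cohomology_class p T a" "b' \<in> cohomology_class p T b" for a' b'
  proof -
    have "(\<lambda>\<sigma>. a \<sigma> - a' \<sigma>) \<in> coboundaries p T" "(\<lambda>\<sigma>. b \<sigma> - b' \<sigma>) \<in> coboundaries p T"
      and ab': "a' \<in> cocycles p T" "b' \<in> cocycles p T"
      using that by (auto simp: cohomologous_def)
    from coboundaries_add[OF this(1,2)]
    have "(\<lambda>\<sigma>. a \<sigma> + b \<sigma> - (a' \<sigma> + b' \<sigma>)) \<in> coboundaries p T"
      by (simp add: algebra_simps)
    then show ?thesis
      by (intro sym[OF iffD2[OF cohomology_class_eq_iff]] cocycles_add a b ab')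
  qed
  moreover have "a \<in> cohomology_class p T a" "b \<in> cohomology_class p T b"
    using a b equiv_class_self[OF equiv_cohomologous] by auto
  ultimately have "(\<Union>a'\<in>cohomology_class p T a. \<Union>b'\<in>cohomology_class p T b.
      cohomology_class p T (\<lambda>\<sigma>. a' \<sigma> + b' \<sigma>)) = cohomology_class p T (\<lambda>\<sigma>. a \<sigma> + b \<sigma>)"
    by blast
  then show ?thesis by (simp add: cohomology_def)
qed

lemma cohomology_smult_class:
  assumes a: "a \<in> cocycles p T"
  shows "r \<odot>\<^bsub>cohomology p T\<^esub> cohomology_class p T a = cohomology_class p T (\<lambda>\<sigma>. r * a \<sigma>)"
proof -
  have "cohomology_class p T (\<lambda>\<sigma>. r * a' \<sigma>) = cohomology_class p T (\<lambda>\<sigma>. r * a \<sigma>)"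
    if "a' \<in> cohomology_class p T a" for a'
  proof -
    have "(\<lambda>\<sigma>. a \<sigma> - a' \<sigma>) \<in> coboundaries p T" and a': "a' \<in> cocycles p T"
      using that by (auto simp: cohomologous_def)
    from coboundaries_scale[OF this(1), of r]
    have "(\<lambda>\<sigma>. r * a \<sigma> - r * a' \<sigma>) \<in> coboundaries p T"
      by (simp add: algebra_simps)
    then show ?thesis
      by (intro sym[OF iffD2[OF cohomology_class_eq_iff]] cocycles_scale a a')
  qed
  moreover have "a \<in> cohomology_class p T a"
    using a equiv_class_self[OF equiv_cohomologous] by auto
  ultimately have "(\<Union>a'\<in>cohomology_class p T a. cohomology_class p T (\<lambda>\<sigma>. r * a' \<sigma>)) =
      cohomology_class p T (\<lambda>\<sigma>. r * a \<sigma>)"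
    by blast
  then show ?thesis by (simp add: cohomology_def)
qed

lemma cohomology_zero_class: "\<zero>\<^bsub>cohomology p T\<^esub> = cohomology_class p T (\<lambda>_. 0)"
  by (simp add: cohomology_def)

lemmas cohomology_class_simps =
  cohomology_add_class cohomology_smult_class cohomology_zero_class cohomology_class_in_carrier
  cocycles_add cocycles_scale cocycles_zero

lemma module_cohomology:
  "Module.module (ring_of_type_algebra :: 'r::comm_ring_1 ring)
    (cohomology p T :: ('r, ('a, 'r) cochain set) module)"
proof (rule moduleI)
  show "Ring.cring (ring_of_type_algebra :: 'r ring)" by (rule cring_from_type_algebra)
  show "abelian_group (cohomology p T :: ('r, ('a, 'r) cochain set) module)"
  proof (rule abelian_groupI)
    fix A assume "A \<in> carrier (cohomology p T :: ('r, ('a, 'r) cochain set) module)"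
    then obtain a :: "('a, 'r) cochain" where a: "a \<in> cocycles p T" "A = cohomology_class p T a"
      by (rule cohomology_carrierE)
    then have "cohomology_class p T (\<lambda>\<sigma>. - 1 * a \<sigma>) \<oplus>\<^bsub>cohomology p T\<^esub> A = \<zero>\<^bsub>cohomology p T\<^esub>"
      using cocycles_scale[OF a(1), of "-1"] by (simp add: cohomology_class_simps)
    then show "\<exists>B\<in>carrier (cohomology p T). B \<oplus>\<^bsub>cohomology p T\<^esub> A = \<zero>\<^bsub>cohomology p T\<^esub>"
      using cohomology_class_in_carrier[OF cocycles_scale[OF a(1), of "-1"]] by blast
  qed (auto elim!: cohomology_carrierE simp: cohomology_class_simps algebra_simps)
qed (auto elim!: cohomology_carrierE simp: cohomology_class_simps algebra_simps ring_of_type_algebra_def)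

lemma finsum_cohomology_classes:
  assumes "finite B" "\<And>b. b \<in> B \<Longrightarrow> a b \<in> cocycles p T"
  shows "finsum (cohomology p T) (\<lambda>b. k b \<odot>\<^bsub>cohomology p T\<^esub> cohomology_class p T (a b)) B =
    cohomology_class p T (\<lambda>\<sigma>. \<Sum>b\<in>B. k b * a b \<sigma>)"
  using assms
proof (induction B rule: finite_induct)
  case empty
  interpret Module.module ring_of_type_algebra "cohomology p T" by (rule module_cohomology)
  show ?case by (simp add: cohomology_zero_class)
next
  case (insert b B)
  interpret Module.module ring_of_type_algebra "cohomology p T" by (rule module_cohomology)
  have "finsum (cohomology p T) (\<lambda>b. k b \<odot>\<^bsub>cohomology p T\<^esub> cohomology_class p T (a b)) (insert b B) =
      (k b \<odot>\<^bsub>cohomology p T\<^esub> cohomology_class p T (a b)) \<oplus>\<^bsub>cohomology p T\<^esub>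
      cohomology_class p T (\<lambda>\<sigma>. \<Sum>b\<in>B. k b * a b \<sigma>)"
    using insert by (subst M.finsum_insert) (auto simp: cohomology_class_simps)
  also have "\<dots> = cohomology_class p T (\<lambda>\<sigma>. \<Sum>b\<in>insert b B. k b * a b \<sigma>)"
    using insert by (simp add: cohomology_class_simps cocycles_sum)
  finally show ?case .
qed

section \<open>Linear relations over an integral domain\<close>

text \<open>
  More unknowns than equations, by elimination. Over a domain one cannot divide by the pivot \<open>f e p\<close>;
  the remaining equations are multiplied by it instead.
\<close>

lemma homogeneous_system_nontrivial_solution:
  fixes f :: "'e \<Rightarrow> 'b \<Rightarrow> 'r::idom"
  assumes "finite E" "finite B" "card E < card B"
  shows "\<exists>c. (\<exists>b\<in>B. c b \<noteq> 0) \<and> (\<forall>e\<in>E. (\<Sum>b\<in>B. c b * f e b) = 0)"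
  using assms
proof (induction E arbitrary: B f rule: finite_induct)
  case empty
  then have "\<exists>b. b \<in> B" by (auto simp: card_gt_0_iff)
  then show ?case by (intro exI[of _ "\<lambda>_. 1"]) auto
next
  case (insert e E)
  show ?case
  proof (cases "\<forall>b\<in>B. f e b = 0")
    case True
    from insert have "card E < card B" by simp
    from insert.IH[OF insert.prems(1) this, of f] True show ?thesis by auto
  next
    case False
    then obtain p where p: "p \<in> B" "f e p \<noteq> 0" by blast
    define B' where "B' = B - {p}"
    have fin: "finite B'" and cB: "card E < card B'"
      using insert p by (auto simp: B'_def)
    from insert.IH[OF this, of "\<lambda>e' b. f e p * f e' b - f e b * f e' p"]
    obtain c where c: "\<exists>b\<in>B'. c b \<noteq> 0"
      and c0: "\<And>e'. e' \<in> E \<Longrightarrow> (\<Sum>b\<in>B'. c b * (f e p * f e' b - f e b * f e' p)) = 0"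
      by blast
    define d where "d b = (if b = p then - (\<Sum>b\<in>B'. c b * f e b) else f e p * c b)" for b
    have split: "(\<Sum>b\<in>B. d b * g b) =
        f e p * (\<Sum>b\<in>B'. c b * g b) - (\<Sum>b\<in>B'. c b * f e b) * g p" for g
    proof -
      have "(\<Sum>b\<in>B. d b * g b) = d p * g p + (\<Sum>b\<in>B'. d b * g b)"
        using p insert.prems by (simp add: B'_def sum.remove)
      also have "(\<Sum>b\<in>B'. d b * g b) = (\<Sum>b\<in>B'. f e p * (c b * g b))"
        by (rule sum.cong) (auto simp: d_def B'_def)
      finally show ?thesis by (simp add: d_def sum_distrib_left)
    qed
    have "(\<Sum>b\<in>B. d b * f e' b) = 0" if "e' \<in> insert e E" for e'
    proof (cases "e' = e")
      case True
      then show ?thesis by (simp add: split mult.commute)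
    next
      case False
      with that c0 show ?thesis
        by (simp add: split right_diff_distrib sum_subtractf sum_distrib_left sum_distrib_right mult_ac)
    qed
    moreover from c have "\<exists>b\<in>B. d b \<noteq> 0"
      using p by (auto simp: d_def B'_def)
    ultimately show ?thesis by blast
  qed
qed

lemma additive_on_int_pow:
  assumes G: "group G" "additive_on G f" and x: "x \<in> carrier G"
  shows "f (x [^]\<^bsub>G\<^esub> (k::int)) = of_int k * f x"
proof -
  interpret group G by fact
  have nat: "f (x [^]\<^bsub>G\<^esub> n) = of_nat n * f x" for n :: nat
  proof (induction n)
    case (Suc n)
    have "f (x [^]\<^bsub>G\<^esub> n \<otimes>\<^bsub>G\<^esub> x) = f (x [^]\<^bsub>G\<^esub> n) + f x"
      using G(2) x by (simp add: additive_on_def)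
    then show ?case by (simp add: Suc algebra_simps)
  qed (simp add: additive_on_one[OF G])
  show ?thesis
  proof (cases k)
    case (nonneg n)
    then show ?thesis by (simp add: int_pow_int nat)
  next
    case (neg n)
    then show ?thesis
      using nat[of "Suc n"] additive_on_inv[OF G, of "x [^]\<^bsub>G\<^esub> Suc n"] x
      by (simp only: int_pow_neg_int nat_pow_closed of_int_minus of_int_of_nat_eq mult_minus_left)
  qed
qed

lemma additive_on_finprod:
  assumes "comm_group G" "additive_on G f" "finite B" "g \<in> B \<rightarrow> carrier G"
  shows "f (finprod G g B) = (\<Sum>b\<in>B. f (g b))"
proof -
  interpret comm_group G by fact
  show ?thesis
    using assms(3,4)
  proof (induction B rule: finite_induct)
    case empty
    then show ?case by (simp add: additive_on_one[OF is_group assms(2)])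
  next
    case (insert b B)
    have "f (g b \<otimes>\<^bsub>G\<^esub> finprod G g B) = f (g b) + f (finprod G g B)"
      using assms(2) insert.prems by (simp add: additive_on_def Pi_iff)
    then show ?case using insert by (simp add: Pi_iff)
  qed
qed

text \<open>
  The families whose sizes are compared in \<^const>\<open>abelian_group_rank\<close>.
\<close>

definition int_independent :: "('g, 'm) monoid_scheme \<Rightarrow> 'g set \<Rightarrow> bool" where
  "int_independent G B \<longleftrightarrow> finite B \<and> B \<subseteq> carrier G \<and>
     (\<forall>c :: 'g \<Rightarrow> int. finprod G (\<lambda>b. b [^]\<^bsub>G\<^esub> c b) B = \<one>\<^bsub>G\<^esub> \<longrightarrow> (\<forall>b\<in>B. c b = 0))"

lemma abelian_group_rank_eq:
  "abelian_group_rank G = Sup {enat (card B) | B. int_independent G B}"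
  by (simp add: abelian_group_rank_def int_independent_def)

text \<open>
  By maximality a nonzero multiple of \<open>z\<close> is a combination of elements of \<open>E\<close>, so \<open>f\<close> vanishes on
  that multiple; in a domain of characteristic 0 the factor can be cancelled.
\<close>

lemma additive_vanishing_on_maximal_independent:
  fixes f :: "'g \<Rightarrow> 'r::{idom, ring_char_0}"
  assumes G: "comm_group G" and f: "additive_on G f"
    and E: "int_independent G E" "\<And>E'. int_independent G E' \<Longrightarrow> card E' \<le> card E"
    and fE: "\<And>e. e \<in> E \<Longrightarrow> f e = 0" and z: "z \<in> carrier G"
  shows "f z = 0"
proof (cases "z \<in> E")
  case False
  interpret comm_group G by fact
  have fin: "finite E" and EG: "E \<subseteq> carrier G" using E(1) by (auto simp: int_independent_def)
  have "\<not> int_independent G (insert z E)"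
    using E(2)[of "insert z E"] fin False by auto
  then obtain c where c: "finprod G (\<lambda>b. b [^]\<^bsub>G\<^esub> (c b :: int)) (insert z E) = \<one>\<^bsub>G\<^esub>"
    and nz: "\<exists>b\<in>insert z E. c b \<noteq> 0"
    using fin EG z by (auto simp: int_independent_def)
  have cl: "(\<lambda>b. b [^]\<^bsub>G\<^esub> c b) \<in> E \<rightarrow> carrier G"
    using EG by auto
  have split: "z [^]\<^bsub>G\<^esub> c z \<otimes>\<^bsub>G\<^esub> finprod G (\<lambda>b. b [^]\<^bsub>G\<^esub> c b) E = \<one>\<^bsub>G\<^esub>"
    using c fin False z cl by simp
  have "c z \<noteq> 0"
  proof
    assume "c z = 0"
    then have "finprod G (\<lambda>b. b [^]\<^bsub>G\<^esub> c b) E = \<one>\<^bsub>G\<^esub>"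
      using split finprod_closed[OF cl] by simp
    then have "\<forall>b\<in>E. c b = 0" using E(1) by (simp add: int_independent_def)
    with nz \<open>c z = 0\<close> show False by simp
  qed
  have "f (finprod G (\<lambda>b. b [^]\<^bsub>G\<^esub> c b) E) = (\<Sum>b\<in>E. of_int (c b) * f b)"
    using additive_on_finprod[OF G f fin cl] EG
    by (simp add: additive_on_int_pow[OF is_group f] subset_iff)
  also have "\<dots> = 0" using fE by simp
  finally have "f (z [^]\<^bsub>G\<^esub> c z) = f \<one>\<^bsub>G\<^esub>"
    using f z finprod_closed[OF cl] unfolding split[symmetric] by (simp add: additive_on_def)
  then have "of_int (c z) * f z = 0"
    using z by (simp add: additive_on_int_pow[OF is_group f] additive_on_one[OF is_group f])
  with \<open>c z \<noteq> 0\<close> show ?thesis by simp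
qed (use fE in auto)

section \<open>Pairing first cohomology with first homology\<close>

lemma coboundary_0:
  "singular_simplex 1 T \<sigma> \<Longrightarrow>
    coboundary 0 T u \<sigma> = u (singular_face 1 0 \<sigma>) - u (singular_face 1 1 \<sigma>)"
  by (simp add: coboundary_def)

lemma chain_boundary_edge:
  "chain_boundary 1 (frag_of \<sigma>) = frag_of (singular_face 1 0 \<sigma>) - frag_of (singular_face 1 1 \<sigma>)"
  by (simp add: chain_boundary_of)

text \<open>
  A potential for \<open>a\<close> is found by integrating from a base point. Call two 0-simplices related if
  their difference is a boundary; choose a base 0-simplex in every class and, for each \<open>s\<close>, a chain
  \<open>w s\<close> from the base to \<open>s\<close>. The potential at \<open>s\<close> is the value of \<open>a\<close> on \<open>w s\<close>: an edge from \<open>t\<close> to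
  \<open>s\<close> differs from \<open>w s - w t\<close> by a cycle.
\<close>

lemma cocycle_vanishing_on_cycles_is_coboundary:
  assumes a: "a \<in> cocycles 1 T"
    and van: "\<And>x. singular_relcycle 1 T {} x \<Longrightarrow> cochain_eval a x = 0"
  shows "a \<in> coboundaries 1 T"
proof -
  define R where "R s t \<longleftrightarrow> (\<exists>w. singular_chain 1 T w \<and> chain_boundary 1 w = frag_of s - frag_of t)" for s t
  have R_refl: "R s s" for s
    unfolding R_def by (rule exI[of _ 0]) simp
  have R_sym: "R t s" if "R s t" for s t
    using that unfolding R_def
  proof (elim exE conjE)
    fix w assume "singular_chain 1 T w" "chain_boundary 1 w = frag_of s - frag_of t"
    then show "\<exists>w. singular_chain 1 T w \<and> chain_boundary 1 w = frag_of t - frag_of s"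
      by (intro exI[of _ "- w"]) (simp add: singular_chain_minus chain_boundary_minus)
  qed
  have R_trans: "R s v" if "R s t" "R t v" for s t v
    using that unfolding R_def
  proof (elim exE conjE)
    fix w1 w2 assume "singular_chain 1 T w1" "chain_boundary 1 w1 = frag_of s - frag_of t"
      "singular_chain 1 T w2" "chain_boundary 1 w2 = frag_of t - frag_of v"
    then show "\<exists>w. singular_chain 1 T w \<and> chain_boundary 1 w = frag_of s - frag_of v"
      by (intro exI[of _ "w1 + w2"]) (simp add: singular_chain_add chain_boundary_add)
  qed
  define base where "base s = (SOME t. R s t)" for s
  have base: "R s (base s)" for s
    unfolding base_def by (rule someI[of "R s", OF R_refl])
  have base_eq: "base s = base t" if "R s t" for s t
  proof -
    have "R s = R t"
      using R_sym R_trans that by (intro ext) blast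
    then show ?thesis by (simp add: base_def)
  qed
  have "\<exists>w. \<forall>s. singular_chain 1 T (w s) \<and> chain_boundary 1 (w s) = frag_of s - frag_of (base s)"
    by (rule choice) (use base in \<open>simp add: R_def\<close>)
  then obtain w where w: "\<And>s. singular_chain 1 T (w s)"
      "\<And>s. chain_boundary 1 (w s) = frag_of s - frag_of (base s)"
    by blast
  define u where "u s = (if singular_simplex 0 T s then cochain_eval a (w s) else 0)" for s
  have "a \<sigma> = coboundary 0 T u \<sigma>" for \<sigma>
  proof (cases "singular_simplex 1 T \<sigma>")
    case True
    define s t where "s = singular_face 1 0 \<sigma>" and "t = singular_face 1 1 \<sigma>"
    have \<sigma>: "singular_chain 1 T (frag_of \<sigma>)" "chain_boundary 1 (frag_of \<sigma>) = frag_of s - frag_of t"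
      using True by (simp_all only: singular_chain_of chain_boundary_edge s_def t_def)
    have st: "singular_simplex 0 T s" "singular_simplex 0 T t"
      using singular_simplex_singular_face[OF True] by (auto simp: s_def t_def)
    have "base s = base t"
      by (intro base_eq[unfolded R_def] exI[of _ "frag_of \<sigma>"] conjI \<sigma>)
    then have "singular_relcycle 1 T {} (frag_of \<sigma> - (w s - w t))"
      using \<sigma> w by (simp add: singular_cycle singular_chain_diff chain_boundary_diff del: One_nat_def)
    from van[OF this] have "a \<sigma> = cochain_eval a (w s) - cochain_eval a (w t)"
      by (simp add: cochain_eval_diff)
    then show ?thesis
      using coboundary_0[OF True, of u, folded s_def t_def] st by (simp add: u_def)
  next
    case False
    then show ?thesis using a by (simp add: cocycles_def cochains_def coboundary_def)
  qed
  then have "a = coboundary 0 T u" by (rule ext)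
  moreover have "u \<in> cochains 0 T" by (simp add: cochains_def u_def)
  ultimately show ?thesis unfolding coboundaries_def by simp
qed

lemma cochain_eval_homologous:
  assumes a: "a \<in> cocycles p T" and "homologous_rel p T {} x y"
  shows "cochain_eval a x = cochain_eval a y"
proof -
  obtain d where d: "singular_chain (Suc p) T d" "chain_boundary (Suc p) d = x - y"
    using assms(2) by (auto simp: homologous_rel_def singular_boundary)
  have "cochain_eval a (x - y) = cochain_eval (\<lambda>_. 0) d"
    using cochain_eval_coboundary[OF d(1), of a] a d(2) by (simp add: cocycles_def)
  then show ?thesis
    by (simp add: cochain_eval_diff) (simp add: cochain_eval_def)
qed

text \<open>
  By \<open>cochain_eval_homologous\<close> the choice of the representing cycle does not matter when \<open>a\<close> is a
  cocycle.
\<close>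

definition homology_pairing :: "('a, 'r::comm_ring_1) cochain \<Rightarrow> 'a chain set \<Rightarrow> 'r" where
  "homology_pairing a z = cochain_eval a (SOME x. x \<in> z)"

lemma homology_pairing_class:
  assumes "a \<in> cocycles p T"
  shows "homology_pairing a (homologous_rel_set p T {} x) = cochain_eval a x"
proof -
  have "homologous_rel p T {} x (SOME y. y \<in> homologous_rel_set p T {} x)"
    using someI[of "\<lambda>y. y \<in> homologous_rel_set p T {} x" x] by simp
  from cochain_eval_homologous[OF assms this] show ?thesis
    by (simp add: homology_pairing_def)
qed

lemma homology_mult_class:
  "homologous_rel_set p T S x \<otimes>\<^bsub>relative_homology_group (int p) T S\<^esub> homologous_rel_set p T S y =
    homologous_rel_set p T S (x + y)"
proof -
  have "\<exists>r. homologous_rel p T S x r \<and> (\<exists>s. homologous_rel p T S y s \<and> z = r + s)"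
    if "homologous_rel p T S (x + y) z" for z
    using that homologous_rel_diff[OF that homologous_rel_refl[of p T S y]]
    by (intro exI[of _ "z - y"] conjI exI[of _ y]) auto
  then show ?thesis
    by (auto simp: mult_relative_homology_group homologous_rel_add)
qed

lemma additive_homology_pairing:
  assumes "a \<in> cocycles p T"
  shows "additive_on (homology_group (int p) T) (homology_pairing a)"
  by (auto simp: additive_on_def carrier_relative_homology_group homology_mult_class
      homology_pairing_class[OF assms] cochain_eval_add)

lemma homology_pairing_linear:
  "homology_pairing (\<lambda>\<sigma>. \<Sum>b\<in>B. k b * a b \<sigma>) z = (\<Sum>b\<in>B. k b * homology_pairing (a b) z)"
  by (simp add: homology_pairing_def cochain_eval_linear)

text \<open>
  If \<open>B\<close> were larger than a maximal independent set \<open>E\<close> of homology classes, the coefficients of a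
  relation could be chosen to kill the pairing with all of \<open>E\<close>, hence with every cycle, so that the
  combination would be a coboundary.
\<close>

theorem submodule_rank_le_first_betti:
  fixes T :: "'a topology" and H :: "('a, 'r::{idom, ring_char_0}) cochain set set"
  assumes H: "H \<subseteq> carrier (cohomology 1 T)"
  shows "submodule_rank (ring_of_type_algebra :: 'r ring) (cohomology 1 T) H \<le> first_betti T"
  unfolding submodule_rank_def
proof (rule Sup_least, clarify)
  fix B assume fin: "finite B" and BH: "B \<subseteq> H"
    and indep: "\<forall>c\<in>B \<rightarrow> carrier (ring_of_type_algebra :: 'r ring).
      finsum (cohomology 1 T) (\<lambda>b. c b \<odot>\<^bsub>cohomology 1 T\<^esub> b) B = \<zero>\<^bsub>cohomology 1 T\<^esub>
      \<longrightarrow> (\<forall>b\<in>B. c b = \<zero>\<^bsub>ring_of_type_algebra\<^esub>)"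
  let ?G = "homology_group 1 T"
  have G: "comm_group ?G" by (rule abelian_relative_homology_group)
  show "enat (card B) \<le> first_betti T"
  proof (rule ccontr)
    assume "\<not> enat (card B) \<le> first_betti T"
    then have small: "card E < card B" if "int_independent ?G E" for E
    proof -
      have "enat (card E) \<le> first_betti T"
        unfolding first_betti_def abelian_group_rank_eq using that by (intro Sup_upper) blast
      also have "\<dots> < enat (card B)"
        using \<open>\<not> enat (card B) \<le> first_betti T\<close> by simp
      finally show ?thesis by simp
    qed
    have "int_independent ?G {}" by (simp add: int_independent_def)
    then obtain E where E: "int_independent ?G E" "\<And>E'. int_independent ?G E' \<Longrightarrow> card E' \<le> card E"
      using ex_has_greatest_nat[of "int_independent ?G" "{}" card "card B"] small by blast
    have "\<exists>a. \<forall>b\<in>B. a b \<in> cocycles 1 T \<and> b = cohomology_class 1 T (a b)"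
      using BH H by (intro bchoice) (blast elim: cohomology_carrierE)
    then obtain a where a: "\<And>b. b \<in> B \<Longrightarrow> a b \<in> cocycles 1 T"
        "\<And>b. b \<in> B \<Longrightarrow> b = cohomology_class 1 T (a b)"
      by blast
    obtain c where c: "\<exists>b\<in>B. c b \<noteq> 0"
      and c0: "\<And>e. e \<in> E \<Longrightarrow> (\<Sum>b\<in>B. c b * homology_pairing (a b) e) = 0"
      using homogeneous_system_nontrivial_solution[of E B "\<lambda>e b. homology_pairing (a b) e"]
        E small fin by (auto simp: int_independent_def)
    define s where "s = (\<lambda>\<sigma>. \<Sum>b\<in>B. c b * a b \<sigma>)"
    have s: "s \<in> cocycles 1 T"
      unfolding s_def using a by (intro cocycles_sum cocycles_scale)
    have "s \<in> coboundaries 1 T"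
    proof (rule cocycle_vanishing_on_cycles_is_coboundary[OF s])
      fix x assume x: "singular_relcycle 1 T {} x"
      have "homology_pairing s (homologous_rel_set 1 T {} x) = 0"
      proof (rule additive_vanishing_on_maximal_independent[OF G _ E])
        show "additive_on ?G (homology_pairing s)"
          using additive_homology_pairing[OF s] by simp
        show "homology_pairing s e = 0" if "e \<in> E" for e
          using c0[OF that] by (simp add: s_def homology_pairing_linear)
        show "homologous_rel_set 1 T {} x \<in> carrier ?G"
          using x carrier_relative_homology_group[of 1 T "{}"] by auto
      qed
      then show "cochain_eval s x = 0" by (simp only: homology_pairing_class[OF s])
    qed
    then have "cohomology_class 1 T s = \<zero>\<^bsub>cohomology 1 T\<^esub>"
      by (simp only: cohomology_class_eq_zero_iff[OF s])
    moreover have "finsum (cohomology 1 T) (\<lambda>b. c b \<odot>\<^bsub>cohomology 1 T\<^esub> b) B =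
        finsum (cohomology 1 T) (\<lambda>b. c b \<odot>\<^bsub>cohomology 1 T\<^esub> cohomology_class 1 T (a b)) B"
    proof -
      interpret Module.module ring_of_type_algebra "cohomology 1 T :: ('r, ('a, 'r) cochain set) module"
        by (rule module_cohomology)
      show ?thesis
      proof (rule M.finsum_cong')
        show "(\<lambda>b. c b \<odot>\<^bsub>cohomology 1 T\<^esub> cohomology_class 1 T (a b)) \<in> B \<rightarrow> carrier (cohomology 1 T)"
          using a(1) by (intro Pi_I smult_closed cohomology_class_in_carrier)
            (auto simp: ring_of_type_algebra_def)
        show "c b \<odot>\<^bsub>cohomology 1 T\<^esub> b = c b \<odot>\<^bsub>cohomology 1 T\<^esub> cohomology_class 1 T (a b)"
          if "b \<in> B" for b
          by (rule arg_cong[OF a(2)[OF that]])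
      qed simp
    qed
    ultimately have "finsum (cohomology 1 T) (\<lambda>b. c b \<odot>\<^bsub>cohomology 1 T\<^esub> b) B = \<zero>\<^bsub>cohomology 1 T\<^esub>"
      using finsum_cohomology_classes[where a = a and k = c, OF fin a(1)] by (simp only: s_def)
    then have "\<forall>b\<in>B. c b = 0"
      using indep by (auto simp: ring_of_type_algebra_def)
    with c show False by blast
  qed
qed

theorem isotropy_index_le_first_betti:
  "isotropy_index TYPE('r::{idom, ring_char_0}) T \<le> first_betti T"
  unfolding isotropy_index_def
proof (rule Sup_least, clarify)
  fix H :: "('a, 'r) cochain set set" assume "isotropic T H"
  then have "H \<subseteq> carrier (cohomology 1 T)"
    using submodule.axioms(1)[of H] subgroup.subset[of H] by (force simp: isotropic_def)
  then show "submodule_rank (ring_of_type_algebra :: 'r ring) (cohomology 1 T) H \<le> first_betti T"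
    by (rule submodule_rank_le_first_betti)
qed

section \<open>Cup products in degree one\<close>

text \<open>Degrees and face indices are written with the numeral 1, which is kept from becoming \<open>Suc 0\<close>.\<close>

declare One_nat_def [simp del]

lemma coboundary_1:
  "singular_simplex 2 T \<sigma> \<Longrightarrow> coboundary 1 T c \<sigma> =
    c (singular_face 2 0 \<sigma>) - c (singular_face 2 1 \<sigma>) + c (singular_face 2 2 \<sigma>)"
  by (simp add: coboundary_def numeral_2_eq_2 One_nat_def)

lemma cocycle_on_triangle:
  assumes "c \<in> cocycles 1 T" "singular_simplex 2 T \<sigma>"
  shows "c (singular_face 2 1 \<sigma>) = c (singular_face 2 2 \<sigma>) + c (singular_face 2 0 \<sigma>)"
proof -
  have "coboundary 1 T c \<sigma> = 0"
    using assms(1) by (simp add: cocycles_def)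
  then show ?thesis
    unfolding coboundary_1[OF assms(2)] by (simp add: algebra_simps eq_neg_iff_add_eq_0)
qed

lemma singular_face_of_triangle:
  "singular_simplex 2 T \<sigma> \<Longrightarrow> k \<le> 2 \<Longrightarrow> singular_simplex 1 T (singular_face 2 k \<sigma>)"
  using singular_simplex_singular_face[of 2 T \<sigma> k] by (simp add: One_nat_def)

lemma cochain_cup_edges:
  assumes "singular_simplex 2 T \<sigma>"
  shows "cochain_cup 1 1 T a b \<sigma> = a (singular_face 2 2 \<sigma>) * b (singular_face 2 0 \<sigma>)"
proof -
  have front: "simplical_face 2 x = x" if "x \<in> standard_simplex (Suc 0)" for x :: "nat \<Rightarrow> real"
    using that by (auto simp: simplical_face_def standard_simplex_def fun_eq_iff)
  have "front_face 1 \<sigma> = singular_face 2 2 \<sigma>"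
    by (auto simp: front_face_def singular_face_def front restrict_def One_nat_def)
  moreover have "back_face 1 1 \<sigma> = singular_face 2 0 \<sigma>"
    unfolding back_face_def singular_face_def simplical_face_def One_nat_def comp_def
    by (simp add: One_nat_def)
  ultimately show ?thesis
    using assms by (simp add: cochain_cup_def)
qed

lemma cochain_cup_non_simplex: "\<not> singular_simplex 2 T \<sigma> \<Longrightarrow> cochain_cup 1 1 T a b \<sigma> = 0"
  by (simp add: cochain_cup_def)

lemma coboundary_non_simplex: "\<not> singular_simplex 2 T \<sigma> \<Longrightarrow> coboundary 1 T c \<sigma> = 0"
  by (simp add: coboundary_def numeral_2_eq_2 One_nat_def)

text \<open>
  Each vertex of a triangle is an end of two of its edges: in this order, the vertices 0, 1 and 2.
\<close>

lemma vertices_of_triangle: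
  "singular_face 1 1 (singular_face 2 2 \<sigma>) = singular_face 1 1 (singular_face 2 1 \<sigma>)"
  "singular_face 1 0 (singular_face 2 2 \<sigma>) = singular_face 1 1 (singular_face 2 0 \<sigma>)"
  "singular_face 1 0 (singular_face 2 1 \<sigma>) = singular_face 1 0 (singular_face 2 0 \<sigma>)"
proof -
  have *: "singular_face 1 i (singular_face 2 j \<sigma>) =
      restrict (\<lambda>x. \<sigma> (simplical_face j (simplical_face i x))) (standard_simplex 0)" if "i \<le> 1" for i j
    using that simplical_face_in_standard_simplex[of 1 i]
    by (auto simp: singular_face_def fun_eq_iff One_nat_def)
  show "singular_face 1 1 (singular_face 2 2 \<sigma>) = singular_face 1 1 (singular_face 2 1 \<sigma>)"
    "singular_face 1 0 (singular_face 2 2 \<sigma>) = singular_face 1 1 (singular_face 2 0 \<sigma>)"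
    "singular_face 1 0 (singular_face 2 1 \<sigma>) = singular_face 1 0 (singular_face 2 0 \<sigma>)"
    by (auto simp: * simplical_face_def standard_simplex_def fun_eq_iff restrict_def
        intro!: arg_cong[of _ _ \<sigma>])
qed

lemma coboundaries_2: "coboundaries 2 T = coboundary 1 T ` cochains 1 T"
  by (simp add: coboundaries_def numeral_2_eq_2 One_nat_def)

lemma coboundaries_1: "coboundaries 1 T = coboundary 0 T ` cochains 0 T"
  by (simp add: coboundaries_def One_nat_def)

lemma coboundaries_diff:
  assumes "a \<in> coboundaries p T" "b \<in> coboundaries p T"
  shows "(\<lambda>\<sigma>. a \<sigma> - b \<sigma>) \<in> coboundaries p T"
  using coboundaries_add[OF assms(1) coboundaries_scale[OF assms(2), of "-1"]] by simp

text \<open>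
  If \<open>a = \<delta>u\<close>, the Leibniz rule and \<open>\<delta>b = 0\<close> lead to the cup product of \<open>u\<close> and \<open>b\<close>, which takes \<open>u\<close>
  at the initial vertex of an edge.
\<close>

lemma cup_coboundary_left:
  assumes a: "a \<in> coboundaries 1 T" and b: "b \<in> cocycles 1 T"
  shows "cochain_cup 1 1 T a b \<in> coboundaries 2 T"
proof -
  obtain u where u: "a = coboundary 0 T u" using a by (auto simp: coboundaries_1)
  define v where "v \<tau> = (if singular_simplex 1 T \<tau> then u (singular_face 1 1 \<tau>) * b \<tau> else 0)" for \<tau>
  have "cochain_cup 1 1 T a b = coboundary 1 T v"
  proof (rule ext)
    fix \<sigma>
    show "cochain_cup 1 1 T a b \<sigma> = coboundary 1 T v \<sigma>"
    proof (cases "singular_simplex 2 T \<sigma>")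
      case True
      note face = singular_face_of_triangle[OF True]
      have edge: "a (singular_face 2 2 \<sigma>) = u (singular_face 1 1 (singular_face 2 0 \<sigma>)) -
          u (singular_face 1 1 (singular_face 2 1 \<sigma>))"
        unfolding u coboundary_0[OF face[OF order_refl]] by (simp only: vertices_of_triangle)
      have val: "v (singular_face 2 k \<sigma>) =
          u (singular_face 1 1 (singular_face 2 k \<sigma>)) * b (singular_face 2 k \<sigma>)" if "k \<le> 2" for k
        using face[OF that] by (simp only: v_def if_True)
      show ?thesis
        unfolding cochain_cup_edges[OF True] coboundary_1[OF True] edge
        by (simp add: val vertices_of_triangle(1) cocycle_on_triangle[OF b True] algebra_simps)
    qed (simp add: cochain_cup_non_simplex coboundary_non_simplex)
  qed
  moreover have "v \<in> cochains 1 T" by (simp add: cochains_def v_def)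
  ultimately show ?thesis by (simp only: coboundaries_2 image_eqI)
qed

text \<open>
  If \<open>b = \<delta>u\<close>, the Leibniz rule and \<open>\<delta>a = 0\<close> lead to minus the cup product of \<open>a\<close> and \<open>u\<close>, which
  takes \<open>u\<close> at the final vertex of an edge.
\<close>

lemma cup_coboundary_right:
  assumes a: "a \<in> cocycles 1 T" and b: "b \<in> coboundaries 1 T"
  shows "cochain_cup 1 1 T a b \<in> coboundaries 2 T"
proof -
  obtain u where u: "b = coboundary 0 T u" using b by (auto simp: coboundaries_1)
  define v where "v \<tau> = (if singular_simplex 1 T \<tau> then - (a \<tau> * u (singular_face 1 0 \<tau>)) else 0)" for \<tau>
  have "cochain_cup 1 1 T a b = coboundary 1 T v"
  proof (rule ext)
    fix \<sigma>
    show "cochain_cup 1 1 T a b \<sigma> = coboundary 1 T v \<sigma>"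
    proof (cases "singular_simplex 2 T \<sigma>")
      case True
      note face = singular_face_of_triangle[OF True]
      have edge: "b (singular_face 2 0 \<sigma>) = u (singular_face 1 0 (singular_face 2 0 \<sigma>)) -
          u (singular_face 1 0 (singular_face 2 2 \<sigma>))"
        unfolding u coboundary_0[OF face[OF le0]] by (simp only: vertices_of_triangle)
      have val: "v (singular_face 2 k \<sigma>) =
          - (a (singular_face 2 k \<sigma>) * u (singular_face 1 0 (singular_face 2 k \<sigma>)))" if "k \<le> 2" for k
        using face[OF that] by (simp only: v_def if_True)
      show ?thesis
        unfolding cochain_cup_edges[OF True] coboundary_1[OF True] edge
        by (simp add: val vertices_of_triangle(3) cocycle_on_triangle[OF a True] algebra_simps)
    qed (simp add: cochain_cup_non_simplex coboundary_non_simplex)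
  qed
  moreover have "v \<in> cochains 1 T" by (simp add: cochains_def v_def)
  ultimately show ?thesis by (simp only: coboundaries_2 image_eqI)
qed

lemma cochain_cup_diff:
  "cochain_cup p q T (\<lambda>\<sigma>. a \<sigma> - a' \<sigma>) b = (\<lambda>\<sigma>. cochain_cup p q T a b \<sigma> - cochain_cup p q T a' b \<sigma>)"
  "cochain_cup p q T a (\<lambda>\<sigma>. b \<sigma> - b' \<sigma>) = (\<lambda>\<sigma>. cochain_cup p q T a b \<sigma> - cochain_cup p q T a b' \<sigma>)"
  by (auto simp: cochain_cup_def fun_eq_iff algebra_simps)

text \<open>
  The cup product of classes is a union over all representatives, so the hypothesis on one pair of
  representatives has to be moved to all pairs; they differ by coboundaries.
\<close>

lemma cup_product_class_zero:
  assumes a: "a \<in> cocycles 1 T" and b: "b \<in> cocycles 1 T"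
    and ab: "cochain_cup 1 1 T a b \<in> coboundaries 2 T"
  shows "cup_product 1 1 T (cohomology_class 1 T a) (cohomology_class 1 T b) = \<zero>\<^bsub>cohomology 2 T\<^esub>"
proof -
  have "cohomology_class (1 + 1) T (cochain_cup 1 1 T a' b') = \<zero>\<^bsub>cohomology 2 T\<^esub>"
    if "a' \<in> cohomology_class 1 T a" "b' \<in> cohomology_class 1 T b" for a' b'
  proof -
    have a': "(\<lambda>\<sigma>. a \<sigma> - a' \<sigma>) \<in> coboundaries 1 T" and b': "(\<lambda>\<sigma>. b \<sigma> - b' \<sigma>) \<in> coboundaries 1 T" "b' \<in> cocycles 1 T"
      using that by (simp_all add: cohomologous_def)
    from coboundaries_diff[OF ab cup_coboundary_right[OF a b'(1)]]
    have "cochain_cup 1 1 T a b' \<in> coboundaries 2 T"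
      by (simp add: cochain_cup_diff)
    from coboundaries_diff[OF this cup_coboundary_left[OF a' b'(2)]]
    have c: "cochain_cup 1 1 T a' b' \<in> coboundaries 2 T"
      by (simp add: cochain_cup_diff)
    have "cohomology_class 2 T (cochain_cup 1 1 T a' b') = \<zero>\<^bsub>cohomology 2 T\<^esub>"
      using c coboundaries_subset_cocycles by (subst cohomology_class_eq_zero_iff) (auto intro: subsetD)
    then show ?thesis by (simp only: one_add_one)
  qed
  moreover have "a \<in> cohomology_class 1 T a" "b \<in> cohomology_class 1 T b"
    using equiv_class_self[OF equiv_cohomologous] a b by auto
  ultimately show ?thesis
    unfolding cup_product_def by blast
qed

section \<open>Isotropic classes from a free quotient\<close>

definition label_cochain ::
  "'a topology \<Rightarrow> (((nat \<Rightarrow> real) \<Rightarrow> 'a) \<Rightarrow> 'g) \<Rightarrow> ('g \<Rightarrow> 'r::comm_ring_1) \<Rightarrow> ('a, 'r) cochain" where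
  "label_cochain T \<rho> f \<sigma> = (if singular_simplex 1 T \<sigma> then f (\<rho> \<sigma>) else 0)"

lemma label_cochain_in_cochains: "label_cochain T \<rho> f \<in> cochains 1 T"
  by (simp add: cochains_def label_cochain_def)

text \<open>
  The dictionary between \<open>F\<close> and the space: the defect \<open>k\<close> of a function on \<open>F\<close> from being additive
  becomes, up to sign, the coboundary of its cochain.
\<close>

lemma label_cochain_triangle:
  assumes \<rho>: "edge_labelling T F \<rho>" and \<sigma>: "singular_simplex 2 T \<sigma>"
    and h: "\<And>x y. \<lbrakk>x \<in> carrier F; y \<in> carrier F\<rbrakk> \<Longrightarrow> h (x \<otimes>\<^bsub>F\<^esub> y) = h x + h y + k x y"
  shows "coboundary 1 T (label_cochain T \<rho> h) \<sigma> =
    - k (\<rho> (singular_face 2 2 \<sigma>)) (\<rho> (singular_face 2 0 \<sigma>))"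
proof -
  note face = singular_face_of_triangle[OF \<sigma>]
  have val: "label_cochain T \<rho> h (singular_face 2 j \<sigma>) = h (\<rho> (singular_face 2 j \<sigma>))"
    "\<rho> (singular_face 2 j \<sigma>) \<in> carrier F" if "j \<le> 2" for j
    using face[OF that] \<rho> unfolding label_cochain_def edge_labelling_def by simp_all
  have "\<rho> (singular_face 2 1 \<sigma>) = \<rho> (singular_face 2 2 \<sigma>) \<otimes>\<^bsub>F\<^esub> \<rho> (singular_face 2 0 \<sigma>)"
    using \<rho> \<sigma> by (simp add: edge_labelling_def One_nat_def)
  then show ?thesis
    unfolding coboundary_1[OF \<sigma>] by (simp add: val h)
qed

lemma label_cochain_cocycle:
  assumes \<rho>: "edge_labelling T F \<rho>" and f: "additive_on F f"
  shows "label_cochain T \<rho> f \<in> cocycles 1 T"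
proof -
  have "coboundary 1 T (label_cochain T \<rho> f) \<sigma> = 0" for \<sigma>
  proof (cases "singular_simplex 2 T \<sigma>")
    case True
    then show ?thesis
      using label_cochain_triangle[OF \<rho> True, of f "\<lambda>_ _. 0"] f by (simp add: additive_on_def)
  qed (rule coboundary_non_simplex)
  then show ?thesis
    unfolding cocycles_def using label_cochain_in_cochains by blast
qed

text \<open>
  Isotropy at the level of cochains: \<open>h\<close> from \<open>free_basis_product_primitive\<close> has the defect
  \<open>f x * g y\<close>, which on a triangle with edge labels \<open>x\<close> and \<open>y\<close> is the value of the cup product.
\<close>

lemma label_cochain_cup:
  fixes f g :: "'g \<Rightarrow> 'r::comm_ring_1"
  assumes F: "group F" "free_basis F B" and \<rho>: "edge_labelling T F \<rho>"
    and f: "additive_on F f" and g: "additive_on F g"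
  shows "cochain_cup 1 1 T (label_cochain T \<rho> f) (label_cochain T \<rho> g) \<in> coboundaries 2 T"
proof -
  obtain h where h: "\<And>x y. \<lbrakk>x \<in> carrier F; y \<in> carrier F\<rbrakk> \<Longrightarrow> h (x \<otimes>\<^bsub>F\<^esub> y) = h x + h y + f x * g y"
    using free_basis_product_primitive[OF F f g] by blast
  have "cochain_cup 1 1 T (label_cochain T \<rho> f) (label_cochain T \<rho> g) \<sigma> =
      - 1 * coboundary 1 T (label_cochain T \<rho> h) \<sigma>" for \<sigma>
  proof (cases "singular_simplex 2 T \<sigma>")
    case True
    note face = singular_face_of_triangle[OF True]
    have "label_cochain T \<rho> f (singular_face 2 2 \<sigma>) = f (\<rho> (singular_face 2 2 \<sigma>))"
      "label_cochain T \<rho> g (singular_face 2 0 \<sigma>) = g (\<rho> (singular_face 2 0 \<sigma>))"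
      unfolding label_cochain_def using face[of 2] face[of 0] by simp_all
    then show ?thesis
      unfolding cochain_cup_edges[OF True]
      by (simp add: label_cochain_triangle[OF \<rho> True, of h "\<lambda>x y. f x * g y"] h)
  qed (simp add: cochain_cup_non_simplex coboundary_non_simplex)
  then have "cochain_cup 1 1 T (label_cochain T \<rho> f) (label_cochain T \<rho> g) =
      (\<lambda>\<sigma>. - 1 * coboundary 1 T (label_cochain T \<rho> h) \<sigma>)"
    by (rule ext)
  also have "\<dots> \<in> coboundaries 2 T"
    unfolding coboundaries_2
    by (rule coboundaries_scale[of _ 2, unfolded coboundaries_2], rule imageI, rule label_cochain_in_cochains)
  finally show ?thesis .
qed

definition label_classes ::
  "'a topology \<Rightarrow> ('g, 'm) monoid_scheme \<Rightarrow> (((nat \<Rightarrow> real) \<Rightarrow> 'a) \<Rightarrow> 'g)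
    \<Rightarrow> ('a, 'r::comm_ring_1) cochain set set" where
  "label_classes T F \<rho> = {cohomology_class 1 T (label_cochain T \<rho> f) | f. additive_on F f}"

lemma isotropic_label_classes:
  assumes F: "group F" "free_basis F B" and \<rho>: "edge_labelling T F \<rho>"
  shows "isotropic T (label_classes T F \<rho> :: ('a, 'r::comm_ring_1) cochain set set)"
proof -
  interpret M: Module.module "ring_of_type_algebra :: 'r ring" "cohomology 1 T :: ('r, ('a, 'r) cochain set) module"
    by (rule module_cohomology)
  let ?H = "label_classes T F \<rho> :: ('a, 'r) cochain set set"
  note coc = label_cochain_cocycle[OF \<rho>]
  have sub: "?H \<subseteq> carrier (cohomology 1 T)"
    unfolding label_classes_def using cohomology_class_in_carrier[OF coc] by blast
  have smult: "r \<odot>\<^bsub>cohomology 1 T\<^esub> A \<in> ?H" if A: "A \<in> ?H" for r A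
  proof -
    obtain f where f: "additive_on F f" "A = cohomology_class 1 T (label_cochain T \<rho> f)"
      using A unfolding label_classes_def by blast
    have "(\<lambda>\<sigma>. r * label_cochain T \<rho> f \<sigma>) = label_cochain T \<rho> (\<lambda>x. r * f x)"
      by (auto simp: label_cochain_def)
    then have "r \<odot>\<^bsub>cohomology 1 T\<^esub> A = cohomology_class 1 T (label_cochain T \<rho> (\<lambda>x. r * f x))"
      unfolding f(2) cohomology_smult_class[OF coc[OF f(1)]] by simp
    moreover have "additive_on F (\<lambda>x. r * f x)"
      using f(1) by (simp add: additive_on_def distrib_left)
    ultimately show ?thesis unfolding label_classes_def by blast
  qed
  have add: "A \<oplus>\<^bsub>cohomology 1 T\<^esub> A' \<in> ?H" if A: "A \<in> ?H" "A' \<in> ?H" for A A'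
  proof -
    obtain f g where f: "additive_on F f" "A = cohomology_class 1 T (label_cochain T \<rho> f)"
      and g: "additive_on F g" "A' = cohomology_class 1 T (label_cochain T \<rho> g)"
      using A unfolding label_classes_def by blast
    have "(\<lambda>\<sigma>. label_cochain T \<rho> f \<sigma> + label_cochain T \<rho> g \<sigma>) = label_cochain T \<rho> (\<lambda>x. f x + g x)"
      by (auto simp: label_cochain_def)
    then have "A \<oplus>\<^bsub>cohomology 1 T\<^esub> A' = cohomology_class 1 T (label_cochain T \<rho> (\<lambda>x. f x + g x))"
      unfolding f(2) g(2) cohomology_add_class[OF coc[OF f(1)] coc[OF g(1)]] by simp
    moreover have "additive_on F (\<lambda>x. f x + g x)"
      using f(1) g(1) by (simp add: additive_on_def)
    ultimately show ?thesis unfolding label_classes_def by blast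
  qed
  have zero: "\<zero>\<^bsub>cohomology 1 T\<^esub> \<in> ?H"
  proof -
    have "label_cochain T \<rho> (\<lambda>_. 0 :: 'r) = (\<lambda>_. 0)"
      by (auto simp: label_cochain_def)
    moreover have "additive_on F (\<lambda>_. 0 :: 'r)" by (simp add: additive_on_def)
    ultimately show ?thesis
      unfolding label_classes_def cohomology_zero_class by force
  qed
  have "submodule ?H ring_of_type_algebra (cohomology 1 T)"
  proof (rule M.submoduleI[OF sub zero _ add smult])
    fix A assume A: "A \<in> ?H"
    then have "\<ominus>\<^bsub>cohomology 1 T\<^esub> A = (\<ominus>\<^bsub>ring_of_type_algebra\<^esub> \<one>\<^bsub>ring_of_type_algebra\<^esub>) \<odot>\<^bsub>cohomology 1 T\<^esub> A"
      using sub by (subst M.smult_l_minus) auto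
    then show "\<ominus>\<^bsub>cohomology 1 T\<^esub> A \<in> ?H" using smult[OF A] by simp
  qed auto
  moreover have "cup_product 1 1 T x y = \<zero>\<^bsub>cohomology 2 T\<^esub>" if xy: "x \<in> ?H" "y \<in> ?H" for x y
  proof -
    obtain f g where "additive_on F f" "x = cohomology_class 1 T (label_cochain T \<rho> f)"
      "additive_on F g" "y = cohomology_class 1 T (label_cochain T \<rho> g)"
      using xy unfolding label_classes_def by blast
    then show ?thesis
      by (simp only: cup_product_class_zero coc label_cochain_cup[OF F \<rho>])
  qed
  ultimately show ?thesis by (simp add: isotropic_def)
qed

text \<open>
  The coboundary of a potential on an edge is a difference of values at its two ends, which coincide
  for a loop. Evaluation on loops therefore separates classes.
\<close>

lemma coboundary_on_loop:
  assumes a: "a \<in> coboundaries 1 T" and p: "p \<in> loops T x0"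
  shows "a (path_simplex p) = 0"
proof -
  obtain u where u: "a = coboundary 0 T u" using a by (auto simp: coboundaries_1)
  have s: "singular_simplex 1 T (path_simplex p)"
    using p by (intro singular_simplex_path_simplex) (simp add: loops_def)
  have "p 0 = p 1" using p by (simp add: loops_def)
  then have "singular_face 1 0 (path_simplex p) = singular_face 1 1 (path_simplex p)"
    using simplical_face_in_standard_simplex[of 1 0] simplical_face_in_standard_simplex[of 1 1]
    by (auto simp: singular_face_def path_simplex_def fun_eq_iff standard_simplex_0 simplical_face_def)
  then show ?thesis unfolding u coboundary_0[OF s] by simp
qed

text \<open>
  The members of \<open>B0\<close> are represented by loops \<open>p b\<close>, and \<open>\<phi> b\<close> is the coordinate function of \<open>b\<close>. The
  cochain of \<open>\<phi> b\<close> takes the value 1 on \<open>p b\<close> and 0 on the other loops, so that evaluation on these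
  loops recovers the coefficients of any linear combination.
\<close>

theorem card_free_basis_le_isotropy_index:
  assumes x0: "x0 \<in> topspace T" and N: "N \<lhd> fundamental_group T x0"
    and B: "free_basis (fundamental_group T x0 Mod N) B" and B0: "finite B0" "B0 \<subseteq> B"
  shows "enat (card B0) \<le> isotropy_index TYPE('r::comm_ring_1) T"
proof -
  let ?G = "fundamental_group T x0" and ?F = "fundamental_group T x0 Mod N"
  let ?M = "cohomology 1 T :: ('r, ('a, 'r) cochain set) module"
  interpret N: normal N ?G by (rule N)
  interpret M: Module.module "ring_of_type_algebra :: 'r ring" ?M
    by (rule module_cohomology)
  have F: "group ?F" by (rule N.factorgroup_is_group)
  obtain \<rho> where \<rho>: "edge_labelling T ?G \<rho>"
    and \<rho>_loop: "\<And>p. p \<in> loops T x0 \<Longrightarrow> \<rho> (path_simplex p) = loop_rel T x0 `` {p}"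
    using exists_edge_labelling[OF x0 N.is_group] by blast
  define \<theta> where "\<theta> \<sigma> = N #>\<^bsub>?G\<^esub> \<rho> \<sigma>" for \<sigma>
  have \<theta>: "edge_labelling T ?F \<theta>"
    unfolding \<theta>_def[abs_def] by (rule edge_labelling_hom[OF \<rho> N.r_coset_hom_Mod])
  have "\<forall>b\<in>B. \<exists>p. p \<in> loops T x0 \<and> \<theta> (path_simplex p) = b"
  proof
    fix b assume that: "b \<in> B"
    have "b \<in> carrier ?F" using B that by (auto simp: free_basis_def)
    then obtain g where g: "g \<in> carrier ?G" "b = N #>\<^bsub>?G\<^esub> g"
      by (auto simp: FactGroup_def RCOSETS_def)
    then obtain p where "p \<in> loops T x0" "g = loop_rel T x0 `` {p}"
      unfolding fundamental_group_carrier by blast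
    with g \<rho>_loop have "\<theta> (path_simplex p) = b" by (simp add: \<theta>_def)
    with \<open>p \<in> loops T x0\<close> show "\<exists>p. p \<in> loops T x0 \<and> \<theta> (path_simplex p) = b" by (intro exI conjI)
  qed
  then have "\<exists>p. \<forall>b\<in>B. p b \<in> loops T x0 \<and> \<theta> (path_simplex (p b)) = b"
    by (rule bchoice)
  then obtain p where p: "\<And>b. b \<in> B \<Longrightarrow> p b \<in> loops T x0" "\<And>b. b \<in> B \<Longrightarrow> \<theta> (path_simplex (p b)) = b"
    by blast
  have "\<exists>\<phi>. \<forall>b. additive_on ?F (\<phi> b) \<and> (\<forall>b'\<in>B. \<phi> b b' = (if b = b' then 1 else 0 :: 'r))"
    by (rule choice, rule allI, rule free_basis_extend_additive[OF F B])
  then obtain \<phi> :: "_ \<Rightarrow> _ \<Rightarrow> 'r" where \<phi>: "\<And>b. additive_on ?F (\<phi> b)"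
    "\<And>b b'. b' \<in> B \<Longrightarrow> \<phi> b b' = (if b = b' then 1 else 0)"
    by blast
  define a where "a b = label_cochain T \<theta> (\<phi> b)" for b
  have a: "a b \<in> cocycles 1 T" for b
    unfolding a_def by (rule label_cochain_cocycle[OF \<theta> \<phi>(1)])
  have a_loop: "a b (path_simplex (p b')) = (if b = b' then 1 else 0)" if "b' \<in> B" for b b'
  proof -
    have "singular_simplex 1 T (path_simplex (p b'))"
      using p(1)[OF that] by (intro singular_simplex_path_simplex) (simp add: loops_def)
    then have "a b (path_simplex (p b')) = \<phi> b (\<theta> (path_simplex (p b')))"
      unfolding a_def label_cochain_def by (rule if_P)
    then show ?thesis using p(2)[OF that] \<phi>(2)[OF that] by simp
  qed
  define cls where "cls b = cohomology_class 1 T (a b)" for b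
  have inj: "inj_on cls B0"
  proof (rule inj_onI)
    fix b b' assume b: "b \<in> B0" "b' \<in> B0" "cls b = cls b'"
    then have "(\<lambda>\<sigma>. a b \<sigma> - a b' \<sigma>) \<in> coboundaries 1 T"
      unfolding cls_def cohomology_class_eq_iff[OF a a] by simp
    from coboundary_on_loop[OF this p(1)] b B0 have "a b (path_simplex (p b)) = a b' (path_simplex (p b))"
      by auto
    with a_loop[of b] b B0 show "b = b'" by (auto split: if_splits)
  qed
  have indep: "\<forall>b\<in>cls ` B0. c b = 0"
    if c: "finsum ?M (\<lambda>b. c b \<odot>\<^bsub>?M\<^esub> b) (cls ` B0) = \<zero>\<^bsub>?M\<^esub>" for c :: "('a, 'r) cochain set \<Rightarrow> 'r"
  proof -
    have cl: "c b \<odot>\<^bsub>?M\<^esub> b \<in> carrier ?M" if "b \<in> cls ` B0" for b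
      using that cohomology_class_in_carrier[OF a]
      by (intro M.smult_closed) (auto simp: ring_of_type_algebra_def cls_def)
    have "finsum ?M (\<lambda>b. c b \<odot>\<^bsub>?M\<^esub> b) (cls ` B0) = finsum ?M (\<lambda>b. c (cls b) \<odot>\<^bsub>?M\<^esub> cls b) B0"
      by (rule M.M.finsum_reindex[OF _ inj]) (use cl in blast)
    also have "\<dots> = cohomology_class 1 T (\<lambda>\<sigma>. \<Sum>b\<in>B0. c (cls b) * a b \<sigma>)"
      unfolding cls_def by (rule finsum_cohomology_classes[OF B0(1) a])
    finally have s: "(\<lambda>\<sigma>. \<Sum>b\<in>B0. c (cls b) * a b \<sigma>) \<in> coboundaries 1 T"
      unfolding c by (subst (asm) eq_commute, subst (asm) cohomology_class_eq_zero_iff)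
        (auto intro!: cocycles_sum cocycles_scale a)
    have "c (cls b) = 0" if b: "b \<in> B0" for b
    proof -
      have bB: "b \<in> B" using b B0 by blast
      have "(\<Sum>b'\<in>B0. c (cls b') * a b' (path_simplex (p b))) = 0"
        by (rule coboundary_on_loop[OF s p(1)[OF bB]])
      then have "(\<Sum>b'\<in>B0. if b' = b then c (cls b') else 0) = 0"
        by (simp add: a_loop[OF bB] if_distrib cong: if_cong)
      then show ?thesis using b B0(1) by simp
    qed
    then show ?thesis by blast
  qed
  have "enat (card B0) = enat (card (cls ` B0))"
    by (simp add: card_image[OF inj])
  also have "\<dots> \<le> submodule_rank (ring_of_type_algebra :: 'r ring) ?M (label_classes T ?F \<theta>)"
    unfolding submodule_rank_def
  proof (rule Sup_upper, intro CollectI exI conjI refl ballI impI)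
    show "finite (cls ` B0)" using B0 by simp
    show "cls ` B0 \<subseteq> label_classes T ?F \<theta>"
      unfolding label_classes_def cls_def a_def using \<phi>(1) by blast
  qed (use indep in \<open>auto simp: ring_of_type_algebra_def\<close>)
  also have "\<dots> \<le> isotropy_index TYPE('r) T"
    unfolding isotropy_index_def using isotropic_label_classes[OF F B \<theta>] by (intro Sup_upper) blast
  finally show ?thesis .
qed

theorem pi1_corank_le_isotropy_index:
  assumes x0: "x0 \<in> topspace T"
  shows "pi1_corank T x0 \<le> isotropy_index TYPE('r::comm_ring_1) T"
  unfolding pi1_corank_def corank_def
proof (rule Sup_least, clarify)
  fix N B assume NB: "N \<lhd> fundamental_group T x0" "free_basis (fundamental_group T x0 Mod N) B"
  note le = card_free_basis_le_isotropy_index[OF x0 NB]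
  show "ecard B \<le> isotropy_index TYPE('r) T"
  proof (cases "finite B")
    case True
    then show ?thesis using le[OF True subset_refl] by (simp add: ecard_def)
  next
    case False
    have "enat n \<le> isotropy_index TYPE('r) T" for n
    proof -
      obtain B0 where "B0 \<subseteq> B" "finite B0" "card B0 = n"
        using infinite_arbitrarily_large[OF False] by blast
      then show ?thesis using le[of B0] by simp
    qed
    then have "isotropy_index TYPE('r) T = \<infinity>"
      by (metis Suc_ile_eq enat.exhaust less_irrefl)
    then show ?thesis by simp
  qed
qed

section \<open>The isotropy index between co-rank and Betti number\<close>

theorem proposition39:
  fixes M :: "'a topology" and n :: nat and A :: "'a chart set" and x0 :: 'a
  assumes "smooth_manifold M n A"
    and "compact_space M"
    and "connected_space M"
    and "orientable_manifold M n A"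
    and "x0 \<in> topspace M"
  shows "(pi1_corank M x0 \<le> isotropy_index TYPE(int) M \<and>
          isotropy_index TYPE(int) M \<le> first_betti M) \<and>
         (pi1_corank M x0 \<le> isotropy_index TYPE('k::field_char_0) M \<and>
          isotropy_index TYPE('k) M \<le> first_betti M)"
  by (intro conjI pi1_corank_le_isotropy_index isotropy_index_le_first_betti assms(5))

end
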